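(* Let $\mathcal{M}$ be a Lawrence oriented matroid of rank $r=7$ on $n\ge 11$ elements. Then $$f_{\mathcal{M}}(7,n,2)\le c_7(n,2).$$
   Context: An oriented matroid $\mathcal{M}=(E,\mathcal{C})$ is given by its finite ground set $E$ and its set $\mathcal{C}\subseteq\{+,-,0\}^E$ of signed circuits; for a sign vector $X$, $X^+$ and $X^-$ are the sets of positive and negative elements and $\underline{X}=X^+\cup X^-$ is the support. All oriented matroids are simple (all circuits have size at least $3$). For $R\subseteq E$, the reorientation ${}_{-R}\mathcal{M}$ is obtained from $\mathcal{M}$ by reversing the sign of $X_e$ for every $e\in R$ and every circuit $X$. For an integer $k\ge 0$, $\mathcal{M}$ is $k$-neighborly if $|X^+|>k$ and $|X^-|>k$ for every circuit $X$. For an oriented matroid $\mathcal{M}$ of rank $r$ on $n$ elements, $f_{\mathcal{M}}(r,n,k)$ denotes the number of subsets $R\subseteq E$ such that ${}_{-R}\mathcal{M}$ is $k$-neighborly. The alternating oriented matroid $C_r(n)$ is the uniform oriented matroid of rank $r$ on $[n]=\{1,\dots,n\}$ in which every circuit $X$ with support $i_1<\dots<i_{r+1}$ satisfies $X_{i_j}=-X_{i_{j+1}}$ for $1\le j\le r$. Put $c_r(n,k)=f_{C_r(n)}(r,n,k)$. Lawrence oriented matroid (LOM): for an $r\times n$ matrix $A=(a_{i,j})$ with entries in $\{+1,-1\}$, $r\le n$, $\mathcal{M}_A$ is the uniform oriented matroid of rank $r$ on $[n]$ with chirotope $\chi(j_1,\dots,j_r)=\prod_{i=1}^r a_{i,j_i}$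 for $j_1<\dots<j_r$. Equivalently, its circuits are the sign vectors $X$ with support $j_1<\dots<j_{r+1}$ such that $X_{j_{i+1}}=-X_{j_i}a_{i,j_i}a_{i,j_{i+1}}$ for $1\le i\le r$. A rank $r$ LOM on $n$ elements is an oriented matroid of the form $\mathcal{M}_A$ for such a matrix $A$. *)

theory Defs
  imports Main
begin

section \<open>Oriented matroids given by signed circuits\<close>

text \<open>A sign vector over \<open>E\<close> is an integer-valued function with values in \<open>{-1, 0, 1}\<close> that is
  \<open>0\<close> outside \<open>E\<close>, so that extensional equality is equality of sign vectors.\<close>

definition sign_vectors :: "'a set \<Rightarrow> ('a \<Rightarrow> int) set" where
  "sign_vectors E = {X. (\<forall>e. X e \<in> {-1, 0, 1}) \<and> (\<forall>e. e \<notin> E \<longrightarrow> X e = 0)}"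

definition pos_part :: "('a \<Rightarrow> int) \<Rightarrow> 'a set" where
  "pos_part X = {e. X e = 1}"

definition neg_part :: "('a \<Rightarrow> int) \<Rightarrow> 'a set" where
  "neg_part X = {e. X e = -1}"

definition support :: "('a \<Rightarrow> int) \<Rightarrow> 'a set" where
  "support X = pos_part X \<union> neg_part X"

record 'a signed_system =
  ground :: "'a set"
  circuits :: "('a \<Rightarrow> int) set"

definition oriented_matroid :: "'a signed_system \<Rightarrow> bool" where
  "oriented_matroid M \<longleftrightarrow>
     finite (ground M) \<and>
     circuits M \<subseteq> sign_vectors (ground M) \<and>
     (\<lambda>e. 0) \<notin> circuits M \<and>
     (\<forall>X \<in> circuits M. (\<lambda>e. - X e) \<in> circuits M) \<and>
     (\<forall>X \<in> circuits M. \<forall>Y \<in> circuits M. support X \<subseteq> support Y \<longrightarrow> X = Y \<or> X = (\<lambda>e. - Y e)) \<and>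
     (\<forall>X \<in> circuits M. \<forall>Y \<in> circuits M. \<forall>e. X \<noteq> (\<lambda>e. - Y e) \<and> e \<in> pos_part X \<inter> neg_part Y \<longrightarrow>
        (\<exists>Z \<in> circuits M. pos_part Z \<subseteq> (pos_part X \<union> pos_part Y) - {e} \<and>
                          neg_part Z \<subseteq> (neg_part X \<union> neg_part Y) - {e}))"

definition simple_om :: "'a signed_system \<Rightarrow> bool" where
  "simple_om M \<longleftrightarrow> (\<forall>X \<in> circuits M. card (support X) \<ge> 3)"

definition independent_in :: "'a signed_system \<Rightarrow> 'a set \<Rightarrow> bool" where
  "independent_in M I \<longleftrightarrow> I \<subseteq> ground M \<and> (\<forall>X \<in> circuits M. \<not> support X \<subseteq> I)"

definition rank_of :: "'a signed_system \<Rightarrow> nat" where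
  "rank_of M = Max (card ` {I. independent_in M I})"

definition uniform_om :: "'a signed_system \<Rightarrow> bool" where
  "uniform_om M \<longleftrightarrow> (\<forall>I. I \<subseteq> ground M \<longrightarrow> (independent_in M I \<longleftrightarrow> card I \<le> rank_of M))"

definition reorient :: "'a set \<Rightarrow> 'a signed_system \<Rightarrow> 'a signed_system" where
  "reorient R M = \<lparr>ground = ground M,
                   circuits = (\<lambda>X e. if e \<in> R then - X e else X e) ` circuits M\<rparr>"

definition neighborly :: "nat \<Rightarrow> 'a signed_system \<Rightarrow> bool" where
  "neighborly k M \<longleftrightarrow> (\<forall>X \<in> circuits M. card (pos_part X) > k \<and> card (neg_part X) > k)"

text \<open>The number \<open>f\<^sub>M(r, n, k)\<close>; the rank \<open>r\<close> and the number \<open>n\<close> of elements are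
  determined by \<open>M\<close> and are not repeated as arguments.\<close>

definition num_neighborly_reorientations :: "'a signed_system \<Rightarrow> nat \<Rightarrow> nat" where
  "num_neighborly_reorientations M k = card {R. R \<subseteq> ground M \<and> neighborly k (reorient R M)}"

section \<open>Alternating and Lawrence oriented matroids\<close>

definition alternating_om :: "nat \<Rightarrow> nat \<Rightarrow> nat signed_system" where
  "alternating_om r n = \<lparr>ground = {1..n},
     circuits = {X \<in> sign_vectors {1..n}. \<exists>j. strict_mono_on {1..r+1} j \<and> support X = j ` {1..r+1} \<and>
       (\<forall>i \<in> {1..r}. X (j i) = - X (j (i + 1)))}\<rparr>"

definition alternating_count :: "nat \<Rightarrow> nat \<Rightarrow> nat \<Rightarrow> nat" where
  "alternating_count r n k = num_neighborly_reorientations (alternating_om r n) k"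

text \<open>The matrix entry \<open>a\<^sub>i\<^sub>j\<close> is \<open>A i j\<close>; only the entries with \<open>1 \<le> i \<le> r\<close> and
  \<open>1 \<le> j \<le> n\<close> matter.\<close>

definition sign_matrix :: "nat \<Rightarrow> nat \<Rightarrow> (nat \<Rightarrow> nat \<Rightarrow> int) \<Rightarrow> bool" where
  "sign_matrix r n A \<longleftrightarrow> (\<forall>i \<in> {1..r}. \<forall>j \<in> {1..n}. A i j \<in> {1, -1})"

definition lawrence_om :: "nat \<Rightarrow> nat \<Rightarrow> (nat \<Rightarrow> nat \<Rightarrow> int) \<Rightarrow> nat signed_system" where
  "lawrence_om r n A = \<lparr>ground = {1..n},
     circuits = {X \<in> sign_vectors {1..n}. \<exists>j. strict_mono_on {1..r+1} j \<and> support X = j ` {1..r+1} \<and>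
       (\<forall>i \<in> {1..r}. X (j (i + 1)) = - X (j i) * A i (j i) * A i (j (i + 1)))}\<rparr>"

definition is_lawrence_om :: "nat \<Rightarrow> nat \<Rightarrow> nat signed_system \<Rightarrow> bool" where
  "is_lawrence_om r n M \<longleftrightarrow> r \<le> n \<and> (\<exists>A. sign_matrix r n A \<and> M = lawrence_om r n A)"

lemma alternating_om_eq_lawrence_om: "alternating_om r n = lawrence_om r n (\<lambda>i j. 1)"
  unfolding alternating_om_def lawrence_om_def
  by (rule arg_cong[where f = "\<lambda>C. \<lparr>ground = {1..n}, circuits = C\<rparr>"])
    (intro Collect_cong conj_cong ex_cong1 ball_cong refl; arith)

section \<open>Adequacy: Lawrence oriented matroids are uniform oriented matroids of rank r\<close>

text \<open>A circuit is handled as the list of its (element, sign) pairs in increasing order.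
  \<open>pat A k\<close> is the sign pattern that consecutive pairs satisfy when the first two elements
  are compared through row \<open>k\<close> of \<open>A\<close>.\<close>

fun pat :: "(nat \<Rightarrow> nat \<Rightarrow> int) \<Rightarrow> nat \<Rightarrow> (nat \<times> int) list \<Rightarrow> bool" where
  "pat A k [] = True"
| "pat A k [(j, s)] = (s \<in> {1, -1})"
| "pat A k ((j, s) # (j', s') # xs) =
     (s \<in> {1, -1} \<and> j < j' \<and> s' = - s * A k j * A k j' \<and> pat A (Suc k) ((j', s') # xs))"

definition negl :: "(nat \<times> int) list \<Rightarrow> (nat \<times> int) list" where
  "negl xs = map (\<lambda>(j, s). (j, - s)) xs"

lemma negl_simps [simp]: "negl [] = []" "negl (x # xs) = (fst x, - snd x) # negl xs"
  "length (negl xs) = length xs" "negl (negl xs) = xs" "map fst (negl xs) = map fst xs"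
  by (auto simp: negl_def o_def case_prod_beta)

lemma pat_negl: "pat A k xs \<Longrightarrow> pat A k (negl xs)"
  by (induction A k xs rule: pat.induct) auto

lemma pat_ConsD: "pat A k (x # xs) \<Longrightarrow> pat A (Suc k) xs"
  by (cases x; cases xs) auto

lemma pat_hd_less: "pat A k (x # xs) \<Longrightarrow> y \<in> set xs \<Longrightarrow> fst x < fst y"
proof (induction xs arbitrary: k x)
  case (Cons z zs)
  then show ?case by (cases x; cases z) fastforce
qed simp

lemma pat_sign: "pat A k xs \<Longrightarrow> y \<in> set xs \<Longrightarrow> snd y \<in> {1, -1}"
proof (induction xs arbitrary: k)
  case (Cons z zs)
  then show ?case by (cases z; cases zs) fastforce+
qed simp

lemma pat_sorted: "pat A k xs \<Longrightarrow> sorted_wrt (<) (map fst xs)"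
proof (induction xs arbitrary: k)
  case (Cons z zs)
  then show ?case using pat_ConsD[OF Cons.prems] pat_hd_less[OF Cons.prems] by auto
qed simp

lemma pat_same: "pat A k xs \<Longrightarrow> pat A k ys \<Longrightarrow> map fst xs = map fst ys \<Longrightarrow> xs = ys \<or> ys = negl xs"
proof (induction A k xs arbitrary: ys rule: pat.induct)
  case (2 A k j s)
  then show ?case by (cases ys) auto
next
  case (3 A k j s j' s' xs)
  then obtain t t' us where ys: "ys = (j, t) # (j', t') # us" by auto
  have "(j', s') # xs = (j', t') # us \<or> (j', t') # us = negl ((j', s') # xs)"
    by (rule 3(1)) (use 3(2-4) ys in auto)
  moreover have "s' \<in> {1, -1}" using pat_sign[OF 3(2), of "(j', s')"] by auto
  ultimately show ?case using 3(2-4) ys by auto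
qed auto

context
  fixes A :: "nat \<Rightarrow> nat \<Rightarrow> int"
  assumes A: "\<And>i j. A i j \<in> {1, -1}"
begin

lemma pat_prepend:
  assumes "pat A (Suc k) ((b, t) # zs)" "a < b"
  shows "pat A k ((a, - t * A k a * A k b) # (b, t) # zs)"
proof -
  have "t \<in> {1, -1}" using pat_sign[OF assms(1), of "(b, t)"] by auto
  then show ?thesis using assms A[of k a] A[of k b] by auto
qed

lemma pat_extend:
  "sorted_wrt (<) (j # js) \<Longrightarrow> s \<in> {1, -1} \<Longrightarrow> \<exists>xs. pat A k ((j, s) # xs) \<and> map fst xs = js"
proof (induction js arbitrary: j s k)
  case (Cons j' js)
  let ?s = "- s * A k j * A k j'"
  have "?s \<in> {1, -1}" using Cons.prems A[of k j] A[of k j'] by auto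
  then obtain xs where "pat A (Suc k) ((j', ?s) # xs)" "map fst xs = js"
    using Cons.IH[of j' ?s "Suc k"] Cons.prems by auto
  then show ?case using Cons.prems by (intro exI[of _ "(j', ?s) # xs"]) auto
qed auto

lemma pat_choose:
  assumes "pat A k (x # x' # xs)" "fst x' < c" "pat A (Suc k) ((c, u) # zs)"
  shows "pat A k (x # (c, u) # zs) \<or> pat A k (x' # (c, u) # zs)"
proof -
  obtain a s b t where x: "x = (a, s)" "x' = (b, t)" by (cases x; cases x') auto
  have "u \<in> {1, -1}" using pat_sign[OF assms(3), of "(c, u)"] by auto
  then show ?thesis using assms x A[of k a] A[of k b] A[of k c] by auto
qed

lemma pat_choose2:
  assumes "pat A (Suc k) ((f, v) # zs)" "a < f" "c < f" "s \<in> {1, -1}" "t \<in> {1, -1}"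
    "t * A k c = - (s * A k a)"
  shows "pat A k ((a, s) # (f, v) # zs) \<or> pat A k ((c, t) # (f, v) # zs)"
proof -
  have "v \<in> {1, -1}" using pat_sign[OF assms(1), of "(f, v)"] by auto
  then have "v = - (s * A k a) * A k f \<or> v = s * A k a * A k f"
    using assms(4) A[of k a] A[of k f] by auto
  then have "v = - s * A k a * A k f \<or> v = - t * A k c * A k f" using assms(6) by simp
  then show ?thesis using assms(1-5) by auto
qed

lemma pat_elim_hd:
  "pat A k ((e, s) # xs) \<Longrightarrow> pat A k ((e, - s) # ys) \<Longrightarrow> length xs = length ys \<Longrightarrow> ys \<noteq> negl xs \<Longrightarrow>
   \<exists>zs. pat A k zs \<and> length zs = Suc (length xs) \<and> set zs \<subseteq> set xs \<union> set ys"
proof (induction xs arbitrary: k e s ys)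
  case (Cons x xs)
  obtain b t where x: "x = (b, t)" by (cases x)
  from Cons.prems obtain c u ys' where ys: "ys = (c, u) # ys'" by (cases ys) auto
  note p = Cons.prems[unfolded x ys]
  have t: "t = - s * A k e * A k b" and u: "u = s * A k e * A k c" using p by auto
  have s: "s \<in> {1, -1}" using p by auto
  consider "b = c" | "b < c" | "c < b" by linarith
  then show ?case
  proof cases
    case 1
    then have ut: "u = - t" using t u by auto
    have "\<exists>zs. pat A (Suc k) zs \<and> length zs = Suc (length xs) \<and> set zs \<subseteq> set xs \<union> set ys'"
      by (rule Cons.IH[of _ b t]) (use p 1 ut in auto)
    then obtain zs where zs: "pat A (Suc k) zs" "length zs = Suc (length xs)" "set zs \<subseteq> set xs \<union> set ys'"
      by blast
    then obtain d v zs' where zs': "zs = (d, v) # zs'" by (cases zs) auto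
    have "b < d"
      using zs(3) zs' pat_hd_less[of A "Suc k" x xs "(d, v)"] pat_hd_less[of A "Suc k" "(c, u)" ys' "(d, v)"]
        p 1 x by auto
    from pat_prepend[OF zs(1)[unfolded zs'] this]
    have q: "pat A k ((b, - v * A k b * A k d) # zs)" using zs' by simp
    moreover have "- v * A k b * A k d \<in> {t, - t}"
      using pat_sign[OF q, of "(b, - v * A k b * A k d)"] s t A[of k e] A[of k b] by auto
    ultimately show ?thesis using zs x ys 1 ut
      by (intro exI[of _ "(b, - v * A k b * A k d) # zs"]) auto
  next
    case 2
    then have "pat A k (x # ys)" using x ys p t u s A[of k e] A[of k b] A[of k c] by auto
    then show ?thesis using p ys by (intro exI[of _ "x # ys"]) auto
  next
    case 3
    then have "pat A k ((c, u) # x # xs)" using x ys p t u s A[of k e] A[of k b] A[of k c] by auto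
    then show ?thesis using p ys by (intro exI[of _ "(c, u) # x # xs"]) auto
  qed
qed auto

lemma pat_elim_hd1:
  assumes "pat A k ((e, s) # xs)" "pat A k (y # ys)" "(e, - s) \<in> set ys" "length xs = length ys"
  shows "\<exists>zs. pat A k zs \<and> length zs = Suc (length xs) \<and>
    set zs \<subseteq> {p \<in> set ((e, s) # xs) \<union> set (y # ys). fst p \<noteq> e}"
proof -
  obtain y' ys' where ys: "ys = y' # ys'" using assms(3) by (cases ys) auto
  obtain b t xs' where xs: "xs = (b, t) # xs'" using assms(4) ys by (cases xs) auto
  obtain c u c' u' where y: "y = (c, u)" "y' = (c', u')" by (cases y; cases y') auto
  have xs_ne: "fst p \<noteq> e" if "p \<in> set xs" for p using pat_hd_less[OF assms(1) that] by auto
  have eb: "e < b" using assms(1) xs by auto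
  have ce: "c < e" using pat_hd_less[OF assms(2,3)] y by auto
  have px: "pat A (Suc k) ((b, t) # xs')" using pat_ConsD[OF assms(1)] xs by simp
  show ?thesis
  proof (cases "c' = e")
    case True
    then have "u' = - s"
      using assms(2,3) ys y pat_hd_less[of A "Suc k" y' ys' "(e, - s)"] by auto
    then have "pat A k (y # xs)"
      using assms(1,2) True ys xs y ce eb A[of k c] A[of k e] A[of k b] by auto
    then show ?thesis using xs_ne ce y by (intro exI[of _ "y # xs"]) auto
  next
    case False
    then have "(e, - s) \<in> set ys'" using assms(3) ys y by auto
    then have c'e: "c' < e"
      using pat_hd_less[of A "Suc k" y' ys' "(e, - s)"] pat_ConsD[OF assms(2)] ys y by auto
    then have "pat A k (y # xs) \<or> pat A k (y' # xs)"
      using pat_choose[of k y y' ys' b t xs'] assms(2) ys y eb px xs by auto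
    then show ?thesis
    proof
      assume "pat A k (y # xs)"
      then show ?thesis using xs_ne ce y by (intro exI[of _ "y # xs"]) auto
    next
      assume "pat A k (y' # xs)"
      then show ?thesis using xs_ne c'e y ys by (intro exI[of _ "y' # xs"]) auto
    qed
  qed
qed

lemma pat_elim:
  "pat A k xs \<Longrightarrow> pat A k ys \<Longrightarrow> length xs = length ys \<Longrightarrow> (e, s) \<in> set xs \<Longrightarrow> (e, - s) \<in> set ys \<Longrightarrow>
   ys \<noteq> negl xs \<Longrightarrow>
   \<exists>zs. pat A k zs \<and> length zs = length xs \<and> set zs \<subseteq> {p \<in> set xs \<union> set ys. fst p \<noteq> e}"
proof (induction xs arbitrary: k ys)
  case (Cons x xs)
  then obtain y ys' where ys: "ys = y # ys'" by (cases ys) auto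
  note p = Cons.prems[unfolded ys]
  have len: "length xs = length ys'" using p by simp
  have nx: "fst q \<noteq> fst x" if "q \<in> set xs" for q using pat_hd_less[OF p(1) that] by auto
  have ny: "fst q \<noteq> fst y" if "q \<in> set ys'" for q using pat_hd_less[OF p(2) that] by auto
  consider (both) "x = (e, s)" "y = (e, - s)" | (left) "x = (e, s)" "(e, - s) \<in> set ys'"
    | (right) "(e, s) \<in> set xs" "y = (e, - s)" | (none) "(e, s) \<in> set xs" "(e, - s) \<in> set ys'"
    using p by auto
  then show ?case
  proof cases
    case both
    then have "\<exists>zs. pat A k zs \<and> length zs = Suc (length xs) \<and> set zs \<subseteq> set xs \<union> set ys'"
      using p by (intro pat_elim_hd[of k e s]) auto
    then obtain zs where zs: "pat A k zs" "length zs = Suc (length xs)" "set zs \<subseteq> set xs \<union> set ys'"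
      by blast
    moreover have "fst q \<noteq> e" if "q \<in> set zs" for q
      using that zs(3) nx[of q] ny[of q] both by auto
    ultimately show ?thesis using ys by (intro exI[of _ zs]) auto
  next
    case left
    have "\<exists>zs. pat A k zs \<and> length zs = Suc (length xs) \<and>
      set zs \<subseteq> {p \<in> set ((e, s) # xs) \<union> set (y # ys'). fst p \<noteq> e}"
      by (rule pat_elim_hd1[OF _ p(2) left(2) len]) (use p(1) left in simp)
    then show ?thesis unfolding ys left(1) by simp
  next
    case right
    have "\<exists>zs. pat A k zs \<and> length zs = Suc (length ys') \<and>
      set zs \<subseteq> {p \<in> set ((e, - s) # ys') \<union> set (x # xs). fst p \<noteq> e}"
      by (rule pat_elim_hd1[OF _ p(1)]) (use p(2) right len in simp_all)
    then show ?thesis unfolding ys right(2) using len by (simp only: Un_commute list.size) simp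
  next
    case none
    obtain x2 xs2 where xs: "xs = x2 # xs2" using none by (cases xs) auto
    obtain y2 ys2 where ys': "ys' = y2 # ys2" using none by (cases ys') auto
    obtain a sa b sb c sc d sd where
      e: "x = (a, sa)" "x2 = (b, sb)" "y = (c, sc)" "y2 = (d, sd)"
      by (cases x; cases x2; cases y; cases y2) auto
    have px: "pat A (Suc k) xs" and py: "pat A (Suc k) ys'" using p pat_ConsD by blast+
    have ae: "a < e" using pat_hd_less[OF p(1) none(1)] e by auto
    have ce: "c < e" using pat_hd_less[OF p(2) none(2)] e by auto
    have be: "b \<le> e" using none(1) xs e px pat_hd_less[of A "Suc k" x2 xs2 "(e, s)"] by auto
    have de: "d \<le> e" using none(2) ys' e py pat_hd_less[of A "Suc k" y2 ys2 "(e, - s)"] by auto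
    have sa: "sa \<in> {1, -1}" and sc: "sc \<in> {1, -1}" using p pat_sign e by force+
    have sb: "sb = - sa * A k a * A k b" and sd: "sd = - sc * A k c * A k d"
      using p e xs ys' by auto
    show ?thesis
    proof (cases "ys' = negl xs")
      case True
      then have bd: "d = b" "sd = - sb" using xs ys' e by auto
      have ac: "a \<noteq> c"
      proof
        assume "a = c"
        then have "sc = - sa" using sb sd bd sa sc A[of k a] A[of k b] by auto
        then show False using \<open>a = c\<close> True p(6) e by auto
      qed
      have main: "\<exists>zs. pat A k zs \<and> length zs = Suc (length xs) \<and>
          set zs \<subseteq> {p \<in> {(a', s'), (c', t')} \<union> set xs \<union> set ys'. fst p \<noteq> e}"
        if h: "a' < c'" "c' < b" "s' \<in> {1, -1}" "t' \<in> {1, -1}" "a' < e" "c' < e"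
          "t' = - s' * A k a' * A k c'" for a' c' s' t'
      proof -
        let ?js = "remove1 e (map fst xs)"
        have srt: "sorted_wrt (<) (map fst xs)" using pat_sorted[OF px] .
        have dist: "distinct (map fst xs)" using srt strict_sorted_iff by blast
        have eS: "e \<in> set (map fst xs)" using none(1) by force
        have "c' < i" if "i \<in> set (map fst xs)" for i
          using srt that h(2) xs e by auto
        then have "\<forall>i \<in> set ?js. c' < i" using notin_set_remove1 by fastforce
        moreover have "sorted_wrt (<) ?js"
          using srt dist by (simp add: strict_sorted_iff sorted_remove1 distinct_remove1)
        ultimately have "sorted_wrt (<) (c' # ?js)" by simp
        from pat_extend[OF this h(4), of "Suc k"] obtain ws
          where ws: "pat A (Suc k) ((c', t') # ws)" "map fst ws = ?js" by blast
        have lws: "Suc (length ws) = length xs"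
          using arg_cong[OF ws(2), of length] eS length_pos_if_in_set[OF none(1)]
          by (simp add: length_remove1)
        have "q \<in> set xs \<union> set ys' \<and> fst q \<noteq> e" if q: "q \<in> set ws" for q
        proof -
          have "fst q \<in> set ?js" using ws(2) q by (metis image_eqI set_map)
          then have f: "fst q \<noteq> e" "fst q \<in> set (map fst xs)" using dist by auto
          then obtain v where v: "(fst q, v) \<in> set xs" by force
          then have v': "(fst q, - v) \<in> set ys'" using True by (force simp: negl_def)
          have "snd q \<in> {1, -1}" "v \<in> {1, -1}"
            using pat_sign[OF ws(1), of q] q pat_sign[OF px v] by auto
          then have "snd q = v \<or> snd q = - v" by auto
          then show ?thesis using v v' f by (metis UnCI prod.collapse)
        qed
        then show ?thesis using ws h lws
          by (intro exI[of _ "(a', s') # (c', t') # ws"]) auto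
      qed
      have ab: "a < b" "c < b" using p e xs ys' bd by auto
      have opp: "sc = - sa * A k a * A k c" "sa = - sc * A k c * A k a"
        using sb sd bd sa sc A[of k a] A[of k b] A[of k c] by auto
      from ac consider "a < c" | "c < a" by linarith
      then show ?thesis
      proof cases
        case 1
        from main[OF this ab(2) sa sc ae ce opp(1)] obtain zs where "pat A k zs" "length zs = Suc (length xs)"
          "set zs \<subseteq> {p \<in> {(a, sa), (c, sc)} \<union> set xs \<union> set ys'. fst p \<noteq> e}" by blast
        then show ?thesis using ys e by (intro exI[of _ zs]) auto
      next
        case 2
        from main[OF this ab(1) sc sa ce ae opp(2)] obtain zs where "pat A k zs" "length zs = Suc (length xs)"
          "set zs \<subseteq> {p \<in> {(c, sc), (a, sa)} \<union> set xs \<union> set ys'. fst p \<noteq> e}" by blast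
        then show ?thesis using ys e by (intro exI[of _ zs]) auto
      qed
    next
      case False
      from Cons.IH[OF px py len none False] obtain zs where
        zs: "pat A (Suc k) zs" "length zs = length xs" "set zs \<subseteq> {p \<in> set xs \<union> set ys'. fst p \<noteq> e}"
        by blast
      then obtain f v zs' where z: "zs = (f, v) # zs'" using xs by (cases zs) auto
      have fv: "(f, v) \<in> set xs \<union> set ys'" "f \<noteq> e" using zs z by auto
      have pre: ?thesis if "w \<in> {x, x2, y, y2}" "fst w \<noteq> e" "pat A k (w # zs)" for w
        using that zs ys xs ys' by (intro exI[of _ "w # zs"]) auto
      have "\<exists>w \<in> {x, x2, y, y2}. fst w \<noteq> e \<and> pat A k (w # zs)"
      proof -
        have chx: "pat A k (x # zs) \<or> pat A k (x2 # zs)" if "b < f"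
          using pat_choose[of k x x2 xs2 f v zs'] p xs that e z zs by auto
        have chy: "pat A k (y # zs) \<or> pat A k (y2 # zs)" if "d < f"
          using pat_choose[of k y y2 ys2 f v zs'] p ys' that e z zs by auto
        show ?thesis
        proof (cases "(f, v) = x2 \<or> (f, v) = y2")
          case True
          then have "pat A k (x # zs) \<or> pat A k (y # zs)"
            using p z zs e xs ys' by auto
          then show ?thesis using ae ce e by auto
        next
          case ne: False
          then have gt: "b < f \<or> d < f"
            using fv xs ys' px py pat_hd_less[of A "Suc k" x2 xs2 "(f, v)"]
              pat_hd_less[of A "Suc k" y2 ys2 "(f, v)"] e by auto
          show ?thesis
          proof (cases "b < f \<and> b \<noteq> e \<or> d < f \<and> d \<noteq> e")
            case True
            then show ?thesis using chx chy ae ce e by auto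
          next
            case nt: False
            then have ef: "e < f" using gt be de by auto
            then have bd: "b = e" "d = e" using nt be de by auto
            have "sb = s" using none(1) xs e bd px pat_hd_less[of A "Suc k" x2 xs2 "(e, s)"] by auto
            moreover have "sd = - s"
              using none(2) ys' e bd py pat_hd_less[of A "Suc k" y2 ys2 "(e, - s)"] by auto
            moreover have "v \<in> {1, -1}" using pat_sign[OF zs(1), of "(f, v)"] z by auto
            ultimately have "(sa * A k a + sc * A k c) * A k e = 0" "v \<in> {1, -1}"
              using sb sd bd by (simp_all add: algebra_simps)
            then have "sc * A k c = - (sa * A k a)" using A[of k e] by auto
            then have "pat A k (x # zs) \<or> pat A k (y # zs)"
              using pat_choose2[of k f v zs' a c sa sc] zs(1) z e sa sc ae ce ef by auto
            then show ?thesis using ae ce e by auto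
          qed
        qed
      qed
      then show ?thesis using pre by blast
    qed
  qed
qed auto

end

definition sv :: "(nat \<times> int) list \<Rightarrow> nat \<Rightarrow> int" where
  "sv xs e = (case map_of xs e of None \<Rightarrow> 0 | Some s \<Rightarrow> s)"

lemma pat_distinct: "pat A k xs \<Longrightarrow> distinct (map fst xs)"
  using pat_sorted strict_sorted_iff by blast

lemma sv_eq_iff:
  assumes "pat A k xs" "s \<noteq> 0"
  shows "sv xs e = s \<longleftrightarrow> (e, s) \<in> set xs"
  using map_of_eq_Some_iff[OF pat_distinct[OF assms(1)], of e s] assms(2)
  by (auto simp: sv_def split: option.splits)

lemma sv_negl: "sv (negl xs) = (\<lambda>e. - sv xs e)"
  by (rule ext, induction xs) (auto simp: sv_def split: option.splits)

lemma sv_zero_one: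
  assumes "pat A k xs"
  shows "sv xs e \<in> {-1, 0, 1}"
proof (cases "sv xs e = 0")
  case False
  then show ?thesis
    using pat_sign[OF assms, of "(e, sv xs e)"] sv_eq_iff[OF assms False, of e] by auto
qed simp

lemma sv_parts:
  assumes "pat A k xs"
  shows "pos_part (sv xs) = {e. (e, 1) \<in> set xs}" "neg_part (sv xs) = {e. (e, -1) \<in> set xs}"
    "support (sv xs) = fst ` set xs"
proof -
  show 1: "pos_part (sv xs) = {e. (e, 1) \<in> set xs}" "neg_part (sv xs) = {e. (e, -1) \<in> set xs}"
    using sv_eq_iff[OF assms] by (auto simp: pos_part_def neg_part_def)
  show "support (sv xs) = fst ` set xs"
    unfolding support_def 1 using pat_sign[OF assms] by force
qed

lemma pat_nth_iff:
  "pat A k xs \<longleftrightarrow> (\<forall>i < length xs. snd (xs ! i) \<in> {1, -1}) \<and>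
     (\<forall>i. Suc i < length xs \<longrightarrow> fst (xs ! i) < fst (xs ! Suc i) \<and>
        snd (xs ! Suc i) = - snd (xs ! i) * A (k + i) (fst (xs ! i)) * A (k + i) (fst (xs ! Suc i)))"
proof (induction A k xs rule: pat.induct)
  case (3 A k j s j' s' xs)
  have all: "(\<forall>i. P i) \<longleftrightarrow> P 0 \<and> (\<forall>i. P (Suc i))" for P :: "nat \<Rightarrow> bool"
    by (metis not0_implies_Suc)
  show ?case unfolding pat.simps 3
    by (subst (3 4) all) auto
qed auto

lemma circuits_lawrence_om:
  "circuits (lawrence_om r n A) =
     {sv xs | xs. pat A 1 xs \<and> length xs = r + 1 \<and> fst ` set xs \<subseteq> {1..n}}"
proof (intro set_eqI iffI)
  fix X assume "X \<in> circuits (lawrence_om r n A)"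
  then obtain j where X: "X \<in> sign_vectors {1..n}" and j: "strict_mono_on {1..r+1} j"
    and sup: "support X = j ` {1..r+1}"
    and rel: "\<And>i. i \<in> {1..r} \<Longrightarrow> X (j (i + 1)) = - X (j i) * A i (j i) * A i (j (i + 1))"
    unfolding lawrence_om_def by auto
  define xs where "xs = map (\<lambda>i. (j (Suc i), X (j (Suc i)))) [0..<r+1]"
  have sgn: "X e \<in> {1, -1}" if "e \<in> support X" for e
    using that by (auto simp: support_def pos_part_def neg_part_def)
  have p: "pat A 1 xs"
    unfolding pat_nth_iff
  proof (intro conjI allI impI)
    fix i assume "i < length xs"
    then show "snd (xs ! i) \<in> {1, -1}"
      using sgn[of "j (Suc i)"] sup by (auto simp: xs_def simp del: upt_Suc)
  next
    fix i assume i: "Suc i < length xs"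
    then have "Suc i \<in> {1..r}" by (auto simp: xs_def)
    then show "fst (xs ! i) < fst (xs ! Suc i)"
      and "snd (xs ! Suc i) = - snd (xs ! i) * A (1 + i) (fst (xs ! i)) * A (1 + i) (fst (xs ! Suc i))"
      using i rel[of "Suc i"] strict_mono_onD[OF j, of "Suc i" "Suc (Suc i)"]
      by (auto simp: xs_def simp del: upt_Suc)
  qed
  have fs: "fst ` set xs = support X"
  proof -
    have "j ` {1..r+1} = (\<lambda>i. j (Suc i)) ` {0..<r+1}"
      by (metis image_Suc_atLeastLessThan image_image atLeastLessThanSuc_atLeastAtMost Suc_eq_plus1 One_nat_def)
    then show ?thesis unfolding sup xs_def by (simp add: image_image del: upt_Suc)
  qed
  have "sv xs = X"
  proof
    fix e show "sv xs e = X e"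
    proof (cases "e \<in> support X")
      case True
      then have "(e, X e) \<in> set xs" using fs unfolding xs_def by auto
      then show ?thesis using sv_eq_iff[OF p, of "X e" e] sgn[OF True] by auto
    next
      case False
      then have "e \<notin> support (sv xs)" using sv_parts(3)[OF p] fs by simp
      then have "sv xs e = 0"
        using sv_zero_one[OF p, of e] by (auto simp: support_def pos_part_def neg_part_def)
      moreover have "X e = 0"
        using False X by (auto simp: sign_vectors_def support_def pos_part_def neg_part_def)
      ultimately show ?thesis by simp
    qed
  qed
  moreover have "support X \<subseteq> {1..n}"
    using X by (auto simp: sign_vectors_def support_def pos_part_def neg_part_def)
  moreover have len: "length xs = r + 1" by (simp add: xs_def)
  ultimately show "X \<in> {sv xs | xs. pat A 1 xs \<and> length xs = r + 1 \<and> fst ` set xs \<subseteq> {1..n}}"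
    using p fs len by blast
next
  fix X assume "X \<in> {sv xs | xs. pat A 1 xs \<and> length xs = r + 1 \<and> fst ` set xs \<subseteq> {1..n}}"
  then obtain xs where X: "X = sv xs" and p: "pat A 1 xs" and l: "length xs = r + 1"
    and sub: "fst ` set xs \<subseteq> {1..n}" by auto
  define j where "j i = fst (xs ! (i - 1))" for i
  have Xj: "X (j i) = snd (xs ! (i - 1))" if "i \<in> {1..r+1}" for i
  proof -
    have m: "xs ! (i - 1) \<in> set xs" using that l by auto
    have "snd (xs ! (i - 1)) \<noteq> 0" using pat_sign[OF p m] by auto
    then show ?thesis using m sv_eq_iff[OF p, of "snd (xs ! (i - 1))" "j i"] X j_def by simp
  qed
  have mono: "strict_mono_on {1..r+1} j"
  proof (rule strict_mono_onI)
    fix a b assume "a \<in> {1..r+1}" "b \<in> {1..r+1}" "a < (b::nat)"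
    then show "j a < j b"
      using sorted_wrt_nth_less[OF pat_sorted[OF p], of "a - 1" "b - 1"] l by (auto simp: j_def)
  qed
  have "support X = fst ` set xs" using sv_parts(3)[OF p] X by simp
  also have "\<dots> = j ` {1..r+1}"
  proof (intro set_eqI iffI)
    fix e assume "e \<in> fst ` set xs"
    then obtain i where "i < r + 1" "e = fst (xs ! i)" using l by (auto simp: in_set_conv_nth)
    then show "e \<in> j ` {1..r+1}" by (intro image_eqI[of _ _ "Suc i"]) (auto simp: j_def)
  qed (use l in \<open>auto simp: j_def\<close>)
  finally have sup: "support X = j ` {1..r+1}" .
  have "X (j (i + 1)) = - X (j i) * A i (j i) * A i (j (i + 1))" if i: "i \<in> {1..r}" for i
  proof -
    obtain m where m: "i = Suc m" using i by (cases i) auto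
    show ?thesis
      using p[unfolded pat_nth_iff] Xj[of i] Xj[of "i + 1"] i l unfolding m j_def by auto
  qed
  moreover have "X \<in> sign_vectors {1..n}"
  proof -
    have "X e = 0" if "e \<notin> {1..n}" for e
    proof -
      have "e \<notin> support X" using that sub sv_parts(3)[OF p] X by auto
      then show ?thesis using sv_zero_one[OF p, of e] X by (auto simp: support_def pos_part_def neg_part_def)
    qed
    then show ?thesis using sv_zero_one[OF p] X by (auto simp: sign_vectors_def)
  qed
  ultimately show "X \<in> circuits (lawrence_om r n A)"
    using mono sup unfolding lawrence_om_def by auto
qed

lemma oriented_matroid_lawrence_aux:
  assumes A: "\<And>i j. A i j \<in> {1, -1}"
  shows "oriented_matroid (lawrence_om r n A)"
proof -
  let ?M = "lawrence_om r n A"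
  let ?P = "\<lambda>xs. pat A 1 xs \<and> length xs = r + 1 \<and> fst ` set xs \<subseteq> {1..n}"
  have C: "circuits ?M = {sv xs | xs. ?P xs}" by (rule circuits_lawrence_om)
  have E: "ground ?M = {1..n}" by (simp add: lawrence_om_def)
  have sv: "circuits ?M \<subseteq> sign_vectors (ground ?M)" by (auto simp: lawrence_om_def)
  have nz: "(\<lambda>e. 0) \<notin> circuits ?M"
    by (auto simp: lawrence_om_def support_def pos_part_def neg_part_def)
  have neg: "(\<lambda>e. - X e) \<in> circuits ?M" if X: "X \<in> circuits ?M" for X
  proof -
    obtain xs where "X = sv xs" "?P xs" using X C by auto
    then have "(\<lambda>e. - X e) = sv (negl xs)" "?P (negl xs)"
      using pat_negl by (auto simp: sv_negl) (auto simp: negl_def)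
    then show ?thesis unfolding C by blast
  qed
  have inc: "X = Y \<or> X = (\<lambda>e. - Y e)"
    if X: "X \<in> circuits ?M" and Y: "Y \<in> circuits ?M" and XY: "support X \<subseteq> support Y" for X Y
  proof -
    obtain xs where xs: "X = sv xs" "?P xs" using X C by auto
    obtain ys where ys: "Y = sv ys" "?P ys" using Y C by auto
    have px: "pat A 1 xs" and py: "pat A 1 ys" using xs ys by auto
    have "card (set (map fst xs)) = card (set (map fst ys))"
      using xs(2) ys(2) distinct_card[OF pat_distinct[OF px]] distinct_card[OF pat_distinct[OF py]]
      by simp
    then have "set (map fst xs) = set (map fst ys)"
      using XY xs(1) ys(1) sv_parts(3)[OF px] sv_parts(3)[OF py] by (intro card_subset_eq) auto
    then have "map fst xs = map fst ys"
      using pat_sorted[OF px] pat_sorted[OF py] strict_sorted_equal by blast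
    then have "ys = xs \<or> xs = negl ys" using pat_same[OF py px] by simp
    then show ?thesis using xs(1) ys(1) sv_negl by metis
  qed
  have elim: "\<exists>Z \<in> circuits ?M. pos_part Z \<subseteq> (pos_part X \<union> pos_part Y) - {e} \<and>
                            neg_part Z \<subseteq> (neg_part X \<union> neg_part Y) - {e}"
    if X: "X \<in> circuits ?M" and Y: "Y \<in> circuits ?M" and ne: "X \<noteq> (\<lambda>e. - Y e)"
      and e: "e \<in> pos_part X \<inter> neg_part Y" for X Y e
  proof -
    obtain xs where xs: "X = sv xs" "?P xs" using X C by auto
    obtain ys where ys: "Y = sv ys" "?P ys" using Y C by auto
    have px: "pat A 1 xs" and py: "pat A 1 ys" and len: "length xs = length ys" using xs ys by auto
    have "(e, 1) \<in> set xs" "(e, - 1) \<in> set ys"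
      using e xs(1) ys(1) sv_parts[OF px] sv_parts[OF py] by auto
    moreover have "ys \<noteq> negl xs" using ne xs(1) ys(1) sv_negl[of xs] by auto
    ultimately obtain zs where zs: "pat A 1 zs" "length zs = length xs"
      "set zs \<subseteq> {p \<in> set xs \<union> set ys. fst p \<noteq> e}"
      using pat_elim[OF A px py len] by blast
    have "fst ` set zs \<subseteq> {1..n}" using zs(3) xs(2) ys(2) by fastforce
    then have "sv zs \<in> circuits ?M" unfolding C using zs xs(2) by auto
    moreover have "pos_part (sv zs) \<subseteq> (pos_part X \<union> pos_part Y) - {e}"
      "neg_part (sv zs) \<subseteq> (neg_part X \<union> neg_part Y) - {e}"
      unfolding xs(1) ys(1) sv_parts[OF px] sv_parts[OF py] sv_parts[OF zs(1)] using zs(3) by auto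
    ultimately show ?thesis by blast
  qed
  show ?thesis
    unfolding oriented_matroid_def using sv nz neg inc elim E by simp
qed

lemma lawrence_om_normalize:
  assumes "sign_matrix r n A"
  obtains B where "\<And>i j. B i j \<in> {1, -1}" "lawrence_om r n A = lawrence_om r n B"
proof
  let ?B = "\<lambda>i j. if i \<in> {1..r} \<and> j \<in> {1..n} then A i j else 1"
  show "?B i j \<in> {1, -1}" for i j using assms by (auto simp: sign_matrix_def)
  have "(\<forall>i \<in> {1..r}. X (j (i + 1)) = - X (j i) * A i (j i) * A i (j (i + 1))) \<longleftrightarrow>
        (\<forall>i \<in> {1..r}. X (j (i + 1)) = - X (j i) * ?B i (j i) * ?B i (j (i + 1)))"
    if "X \<in> sign_vectors {1..n}" "support X = j ` {1..r+1}" for X j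
  proof -
    have "support X \<subseteq> {1..n}"
      using that(1) by (auto simp: sign_vectors_def support_def pos_part_def neg_part_def)
    then have "j i \<in> {1..n} \<and> j (i + 1) \<in> {1..n}" if "i \<in> {1..r}" for i
      using that \<open>support X = _\<close> by (auto simp: image_subset_iff)
    then show ?thesis by (intro ball_cong refl) simp
  qed
  note cond = this
  show "lawrence_om r n A = lawrence_om r n ?B"
    unfolding lawrence_om_def
    by (rule arg_cong[where f = "\<lambda>C. \<lparr>ground = {1..n}, circuits = C\<rparr>"])
      (intro Collect_cong conj_cong ex_cong1 refl cond; assumption)
qed

theorem is_lawrence_om_oriented_matroid: "is_lawrence_om r n M \<Longrightarrow> oriented_matroid M"
  unfolding is_lawrence_om_def using lawrence_om_normalize oriented_matroid_lawrence_aux by metis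

lemma circuit_supports_lawrence_om:
  assumes "is_lawrence_om r n M"
  shows "support ` circuits M = {S. S \<subseteq> ground M \<and> card S = r + 1}"
proof -
  from assms obtain A where "sign_matrix r n A" "M = lawrence_om r n A"
    unfolding is_lawrence_om_def by auto
  then obtain B where B: "\<And>i j. B i j \<in> {1, -1}" and M: "M = lawrence_om r n B"
    using lawrence_om_normalize by metis
  have E: "ground M = {1..n}" by (simp add: M lawrence_om_def)
  show ?thesis
  proof (intro set_eqI iffI)
    fix S assume "S \<in> support ` circuits M"
    then obtain xs where xs: "S = support (sv xs)" "pat B 1 xs" "length xs = r + 1" "fst ` set xs \<subseteq> {1..n}"
      unfolding M circuits_lawrence_om by auto
    then show "S \<in> {S. S \<subseteq> ground M \<and> card S = r + 1}"
      using sv_parts(3)[OF xs(2)] distinct_card[OF pat_distinct[OF xs(2)]] E by simp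
  next
    fix S assume S: "S \<in> {S. S \<subseteq> ground M \<and> card S = r + 1}"
    let ?L = "sorted_list_of_set S"
    have fin: "finite S" using S E finite_subset by auto
    obtain j js where L: "?L = j # js" using S fin by (cases ?L) auto
    have "sorted_wrt (<) (j # js)" using strict_sorted_list_of_set[of S] L by simp
    then obtain xs where xs: "pat B 1 ((j, 1) # xs)" "map fst xs = js"
      using pat_extend[of B j js 1 1, OF B] by auto
    let ?xs = "(j, 1) # xs"
    have f: "fst ` set ?xs = S"
      using xs(2) L fin by (metis fst_conv list.set_map list.simps(9) set_sorted_list_of_set)
    moreover have "length ?xs = r + 1"
      using xs(2) L S by (metis (mono_tags) length_map length_sorted_list_of_set list.simps(9) fst_conv mem_Collect_eq)
    moreover have "fst ` set ?xs \<subseteq> {1..n}" using f S E by simp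
    ultimately have "sv ?xs \<in> circuits M" unfolding M circuits_lawrence_om using xs(1) by blast
    moreover have "support (sv ?xs) = S" using sv_parts(3)[OF xs(1)] f by simp
    ultimately show "S \<in> support ` circuits M" by blast
  qed
qed

theorem is_lawrence_om_uniform:
  assumes "is_lawrence_om r n M"
  shows "card (ground M) = n" "rank_of M = r" "uniform_om M" "r \<ge> 2 \<Longrightarrow> simple_om M"
proof -
  have E: "ground M = {1..n}" and rn: "r \<le> n"
    using assms by (auto simp: is_lawrence_om_def lawrence_om_def)
  show "card (ground M) = n" using E by simp
  have ind: "independent_in M I \<longleftrightarrow> card I \<le> r" if I: "I \<subseteq> ground M" for I
  proof -
    have fin: "finite I" using I E finite_subset by auto
    have "(\<exists>X \<in> circuits M. support X \<subseteq> I) \<longleftrightarrow> (\<exists>S \<in> support ` circuits M. S \<subseteq> I)" by blast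
    also have "\<dots> \<longleftrightarrow> (\<exists>S. S \<subseteq> I \<and> card S = r + 1)"
      unfolding circuit_supports_lawrence_om[OF assms] using I by auto
    also have "\<dots> \<longleftrightarrow> r + 1 \<le> card I"
      using card_mono[OF fin] obtain_subset_with_card_n[of "r + 1" I] by metis
    finally show ?thesis using I unfolding independent_in_def by auto
  qed
  have "card ` {I. independent_in M I} = {..r}"
  proof (intro set_eqI iffI)
    fix m assume "m \<in> card ` {I. independent_in M I}"
    then show "m \<in> {..r}" using ind by (auto simp: independent_in_def)
  next
    fix m assume "m \<in> {..r}"
    then have "card {1..m} = m" "{1..m} \<subseteq> ground M" using rn E by auto
    then show "m \<in> card ` {I. independent_in M I}" 
      using ind[of "{1..m}"] \<open>m \<in> {..r}\<close> by (intro image_eqI[of _ _ "{1..m}"]) auto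
  qed
  then show rk: "rank_of M = r" unfolding rank_of_def
    by (simp add: Max_eq_iff)
  show "uniform_om M" unfolding uniform_om_def rk using ind by blast
  show "simple_om M" if "r \<ge> 2"
  proof -
    have "card (support X) = r + 1" if "X \<in> circuits M" for X
      using imageI[OF that, of support] circuit_supports_lawrence_om[OF assms] by simp
    then show ?thesis unfolding simple_om_def using that by simp
  qed
qed

text \<open>The circuits of \<open>lawrence_om r n A\<close> are those determined by the chirotope below: on a
  support \<open>j 1 < \<dots> < j (r + 1)\<close>, the sign at \<open>j i\<close> is, up to a global sign, \<open>(-1)\<^sup>i\<close> times
  the chirotope on the support with \<open>j i\<close> omitted.\<close>

definition lawrence_chirotope :: "nat \<Rightarrow> (nat \<Rightarrow> nat \<Rightarrow> int) \<Rightarrow> (nat \<Rightarrow> nat) \<Rightarrow> int" where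
  "lawrence_chirotope r A j = (\<Prod>i = 1..r. A i (j i))"

definition omit :: "nat \<Rightarrow> (nat \<Rightarrow> nat) \<Rightarrow> nat \<Rightarrow> nat" where
  "omit i j m = (if m < i then j m else j (m + 1))"

lemma prod_sign: "finite S \<Longrightarrow> \<forall>m \<in> S. f m \<in> {1, -1 :: int} \<Longrightarrow> prod f S \<in> {1, -1}"
  by (induction S rule: finite_induct) auto

theorem circuits_lawrence_om_chirotope:
  assumes "sign_matrix r n A"
  shows "circuits (lawrence_om r n A) =
    {X \<in> sign_vectors {1..n}. \<exists>j. strict_mono_on {1..r+1} j \<and> support X = j ` {1..r+1} \<and>
      (\<forall>i \<in> {1..r}. X (j (i + 1)) * lawrence_chirotope r A (omit (i + 1) j) =
                   - X (j i) * lawrence_chirotope r A (omit i j))}"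
proof -
  have "X (j (i + 1)) = - X (j i) * A i (j i) * A i (j (i + 1)) \<longleftrightarrow>
        X (j (i + 1)) * lawrence_chirotope r A (omit (i + 1) j) =
        - X (j i) * lawrence_chirotope r A (omit i j)"
    if X: "X \<in> sign_vectors {1..n}" and sup: "support X = j ` {1..r+1}" and i: "i \<in> {1..r}" for X j i
  proof -
    have "support X \<subseteq> {1..n}"
      using X by (auto simp: sign_vectors_def support_def pos_part_def neg_part_def)
    then have jn: "j m \<in> {1..n}" if "m \<in> {1..r+1}" for m
      using imageI[OF that, of j] sup by blast
    define P where "P = (\<Prod>m \<in> {1..r} - {i}. A m (omit i j m))"
    have "A m (omit i j m) \<in> {1, -1}" if m: "m \<in> {1..r} - {i}" for m
      using assms jn[of m] jn[of "m + 1"] m by (auto simp: sign_matrix_def omit_def)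
    then have P: "P \<in> {1, -1}" unfolding P_def by (intro prod_sign) auto
    have 1: "lawrence_chirotope r A (omit i j) = A i (j (i + 1)) * P"
      unfolding lawrence_chirotope_def P_def using i by (subst prod.remove[of _ i]) (auto simp: omit_def)
    have "P = (\<Prod>m \<in> {1..r} - {i}. A m (omit (i + 1) j m))"
      unfolding P_def by (intro prod.cong) (auto simp: omit_def)
    then have 2: "lawrence_chirotope r A (omit (i + 1) j) = A i (j i) * P"
      unfolding lawrence_chirotope_def using i by (subst prod.remove[of _ i]) (auto simp: omit_def)
    have "A i (j i) \<in> {1, -1}" "A i (j (i + 1)) \<in> {1, -1}"
      using assms i jn[of i] jn[of "i + 1"] by (auto simp: sign_matrix_def)
    then show ?thesis unfolding 1 2 using P by auto
  qed
  note cond = this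
  show ?thesis
    unfolding lawrence_om_def signed_system.simps
    by (intro Collect_cong conj_cong ex_cong1 ball_cong refl cond; assumption)
qed

end

theory Submission
  imports Defs Complex_Main
begin

text \<open>The idea is a polynomial (dimension) argument. Encode a reorientation \<open>R\<close> by the signs
  \<open>v\<^sub>e = flip R e\<close>. It is 2-neighborly iff, for every circuit \<open>X\<close>, the sum \<open>\<Sum>X\<^sub>e v\<^sub>e\<close> over the eight
  elements of the support lies in \<open>{-2, 0, 2}\<close>. Complementation preserves this, so it suffices to
  count the family \<open>\<F>\<close> of those \<open>R\<close> that avoid a fixed element \<open>l\<close>, that is, those with \<open>v\<^sub>l = 1\<close>.

  Integers in \<open>{-2, 0, 2}\<close> are roots of the cubic \<open>t\<^sup>3 - 4t\<close>. For a circuit with support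
  \<open>C \<union> {l}\<close>, where \<open>C\<close> has seven elements, this says that the third elementary symmetric function
  of the signs \<open>X\<^sub>e v\<^sub>e\<close>, \<open>e \<in> C\<close>, agrees on \<open>\<F>\<close> with a polynomial of degree at most 2
  (\<open>cubic_relation_of_balanced_signs\<close>). These relations can be solved for the cubic
  monomials: within a 10-element set, the coefficient matrix is square, indexed by 7-sets and
  3-sets, and modulo 2 it is the inclusion matrix, whatever the signs of the circuits are.
  For 3-sets \<open>P\<close> and \<open>S\<close> the number of 7-sets containing both is 35, 20, 10 or 4
  according to \<open>|P \<union> S| = 3, 4, 5, 6\<close>, so the inclusion matrix times its transpose is the
  identity modulo 2 and the matrix is invertible over the rationals
  (\<open>triples_determined_by_signed_sums\<close>). Hence on \<open>\<F>\<close> every squarefree monomial of degree at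
  least 3 reduces to lower degree, all functions on \<open>\<F>\<close> are polynomials of degree at most 2, and
  \<open>|\<F>|\<close> is at most the number of sets of at most two elements different from \<open>l\<close>
  (\<open>card_balanced_family\<close>). All of this is carried out dually, for an integer
  function on \<open>\<F>\<close> that is orthogonal to all monomials of degree at most 2.

  In the alternating oriented matroid every interval is a 2-neighborly reorientation
  (\<open>interval_reorientation_neighborly\<close>). With \<open>l = n\<close>, there are as many intervals in
  \<open>{1..n-1}\<close>, the empty one included, as subsets with at most two elements, so the
  alternating oriented matroid attains the bound.

  The Lawrence structure enters through the fact that every set of eight elements supports a
  circuit (\<open>circuit_supports_lawrence_om\<close>).\<close>

section \<open>Integer linear systems\<close>

lemma homogeneous_system_nontrivial:
  fixes A :: "'i \<Rightarrow> 'j \<Rightarrow> int"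
  assumes "finite I" "finite J" "card I < card J"
  shows "\<exists>x. (\<exists>j\<in>J. x j \<noteq> 0) \<and> (\<forall>i\<in>I. (\<Sum>j\<in>J. A i j * x j) = 0)"
  using assms
proof (induction I arbitrary: A J rule: finite_induct)
  case empty
  then obtain j where "j \<in> J" by fastforce
  then show ?case by (intro exI[of _ "\<lambda>_. 1"]) auto
next
  case (insert i I)
  show ?case
  proof (cases "\<forall>j\<in>J. A i j = 0")
    case True
    obtain x where "\<exists>j\<in>J. x j \<noteq> 0" "\<forall>i\<in>I. (\<Sum>j\<in>J. A i j * x j) = 0"
      using insert.IH[of J A] insert.hyps insert.prems by auto
    then show ?thesis using True by (intro exI[of _ x]) auto
  next
    case False
    then obtain k where k: "k \<in> J" "A i k \<noteq> 0" by blast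
    \<comment> \<open>Gaussian elimination of the unknown \<open>k\<close>, without division.\<close>
    define B where "B i' j = A i k * A i' j - A i' k * A i j" for i' j
    have "card I < card (J - {k})" using insert.hyps insert.prems k by simp
    then obtain x where x: "\<exists>j\<in>J - {k}. x j \<noteq> 0"
      "\<forall>i'\<in>I. (\<Sum>j\<in>J - {k}. B i' j * x j) = 0"
      using insert.IH[of "J - {k}" B] insert.prems by auto
    define s where "s i' = (\<Sum>j\<in>J - {k}. A i' j * x j)" for i'
    define y where "y j = (if j = k then - s i else A i k * x j)" for j
    have sum_y: "(\<Sum>j\<in>J. A i' j * y j) = A i k * s i' - A i' k * s i" for i'
    proof -
      have "(\<Sum>j\<in>J. A i' j * y j) = A i' k * y k + (\<Sum>j\<in>J - {k}. A i' j * y j)"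
        using k insert.prems by (simp add: sum.remove)
      also have "(\<Sum>j\<in>J - {k}. A i' j * y j) = A i k * s i'"
        unfolding s_def sum_distrib_left by (intro sum.cong) (auto simp: y_def)
      finally show ?thesis by (simp add: y_def)
    qed
    have "A i k * s i' - A i' k * s i = (\<Sum>j\<in>J - {k}. B i' j * x j)" for i'
      unfolding s_def B_def sum_distrib_left
      by (simp add: sum_subtractf[symmetric] algebra_simps)
    then have "\<forall>i'\<in>I. (\<Sum>j\<in>J. A i' j * y j) = 0" using x(2) sum_y by simp
    moreover have "(\<Sum>j\<in>J. A i j * y j) = 0" using sum_y[of i] by simp
    ultimately have "\<forall>i'\<in>insert i I. (\<Sum>j\<in>J. A i' j * y j) = 0" by simp
    moreover have "\<exists>j\<in>J. y j \<noteq> 0" using x(1) k by (auto simp: y_def)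
    ultimately show ?thesis by blast
  qed
qed

text \<open>The determinant of such a matrix is odd. Without determinants: if \<open>2\<^sup>m\<close> divides all entries of
  a solution, then the \<open>i\<close>-th equation shows that \<open>2\<^sup>m\<^sup>+\<^sup>1\<close> divides \<open>x i\<close>.\<close>

lemma identity_mod_2_nonsingular:
  fixes w :: "'i \<Rightarrow> 'i \<Rightarrow> int" and x :: "'i \<Rightarrow> int"
  assumes "finite I"
    and diag: "\<And>i. i \<in> I \<Longrightarrow> odd (w i i)"
    and off: "\<And>i j. i \<in> I \<Longrightarrow> j \<in> I \<Longrightarrow> i \<noteq> j \<Longrightarrow> even (w i j)"
    and sys: "\<And>i. i \<in> I \<Longrightarrow> (\<Sum>j\<in>I. w i j * x j) = 0"
    and "i \<in> I"
  shows "x i = 0"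
proof -
  have dvd: "2 ^ m dvd x i" if "i \<in> I" for m i
    using that
  proof (induction m arbitrary: i)
    case (Suc m)
    have "w i i * x i = - (\<Sum>j\<in>I - {i}. w i j * x j)"
      using sys[OF Suc.prems] \<open>finite I\<close> Suc.prems by (simp add: sum.remove)
    moreover have "2 * 2 ^ m dvd (\<Sum>j\<in>I - {i}. w i j * x j)"
      using off Suc by (intro dvd_sum mult_dvd_mono) auto
    ultimately have "2 ^ Suc m dvd w i i * x i" by simp
    moreover have "coprime (2 ^ Suc m) (w i i)" using diag[OF Suc.prems] by simp
    ultimately show ?case by (simp only: coprime_dvd_mult_right_iff)
  qed simp
  show ?thesis
  proof (rule ccontr)
    assume "x i \<noteq> 0"
    then have "2 ^ nat \<bar>x i\<bar> \<le> \<bar>x i\<bar>"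
      using dvd_imp_le_int[OF _ dvd[OF \<open>i \<in> I\<close>]] by simp
    moreover have "int (nat \<bar>x i\<bar>) < int (2 ^ nat \<bar>x i\<bar>)"
      unfolding of_nat_less_iff by (rule less_exp)
    ultimately show False by simp
  qed
qed

section \<open>Elementary symmetric functions of signs\<close>

definition esym :: "nat \<Rightarrow> 'a set \<Rightarrow> ('a \<Rightarrow> int) \<Rightarrow> int" where
  "esym k C s = (\<Sum>T | T \<subseteq> C \<and> card T = k. \<Prod>e\<in>T. s e)"

lemma esym_0: "finite C \<Longrightarrow> esym 0 C s = 1"
proof -
  assume "finite C"
  then have "{T. T \<subseteq> C \<and> card T = 0} = {{}}" using finite_subset by fastforce
  then show ?thesis by (simp add: esym_def)
qed

lemma esym_empty: "esym (Suc k) {} s = 0"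
proof -
  show ?thesis unfolding esym_def by (rule sum.neutral) auto
qed

lemma esym_insert:
  assumes "finite C" "x \<notin> C"
  shows "esym (Suc k) (insert x C) s = esym (Suc k) C s + s x * esym k C s"
proof -
  let ?S = "\<lambda>k C. {T. T \<subseteq> C \<and> card T = k}"
  have fin: "finite (?S k C)" for k using assms by simp
  have split: "?S (Suc k) (insert x C) = ?S (Suc k) C \<union> insert x ` ?S k C"
  proof (intro set_eqI iffI)
    fix T assume T: "T \<in> ?S (Suc k) (insert x C)"
    then have fT: "finite T" using assms(1) finite_subset by fastforce
    show "T \<in> ?S (Suc k) C \<union> insert x ` ?S k C"
    proof (cases "x \<in> T")
      case True
      then have "T = insert x (T - {x})" "T - {x} \<in> ?S k C" using T fT by auto
      then show ?thesis by blast
    qed (use T in auto)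
  next
    fix T assume "T \<in> ?S (Suc k) C \<union> insert x ` ?S k C"
    then consider "T \<in> ?S (Suc k) C" | D where "T = insert x D" "D \<subseteq> C" "card D = k" by auto
    then show "T \<in> ?S (Suc k) (insert x C)"
    proof cases
      case 2
      then have "finite D" "x \<notin> D" using assms finite_subset by auto
      then show ?thesis using 2 by auto
    qed auto
  qed
  have inj: "inj_on (insert x) (?S k C)"
    using assms(2) by (intro inj_onI) (metis (no_types, lifting) Diff_insert_absorb mem_Collect_eq subsetD)
  have "esym (Suc k) (insert x C) s = esym (Suc k) C s + (\<Sum>T\<in>insert x ` ?S k C. \<Prod>e\<in>T. s e)"
    unfolding esym_def split using assms fin by (intro sum.union_disjoint) auto
  also have "(\<Sum>T\<in>insert x ` ?S k C. \<Prod>e\<in>T. s e) = (\<Sum>D\<in>?S k C. \<Prod>e\<in>insert x D. s e)"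
    using inj by (simp add: sum.reindex)
  also have "\<dots> = s x * esym k C s"
    unfolding esym_def sum_distrib_left
  proof (intro sum.cong refl)
    fix D assume "D \<in> ?S k C"
    then have "finite D" "x \<notin> D" using assms finite_subset by auto
    then show "(\<Prod>e\<in>insert x D. s e) = s x * (\<Prod>e\<in>D. s e)" by simp
  qed
  finally show ?thesis .
qed

lemma esym_1: "finite C \<Longrightarrow> esym (Suc 0) C s = (\<Sum>e\<in>C. s e)"
  by (induction C rule: finite_induct) (simp_all add: esym_empty esym_insert esym_0)

lemma square_sum_signs:
  assumes "finite C" "\<forall>e\<in>C. s e \<in> {1, -1 :: int}"
  shows "(\<Sum>e\<in>C. s e)\<^sup>2 = int (card C) + 2 * esym 2 C s"
  using assms
proof (induction C rule: finite_induct)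
  case empty
  then show ?case using esym_empty[of 1] by (simp add: numeral_2_eq_2)
next
  case (insert x C)
  have "(s x)\<^sup>2 = 1" using insert.prems by auto
  moreover have "esym 2 (insert x C) s = esym 2 C s + s x * (\<Sum>e\<in>C. s e)"
    using esym_insert[OF insert.hyps, of 1] esym_1[OF insert.hyps(1)] by (simp add: numeral_2_eq_2)
  ultimately show ?case using insert by (simp add: power2_sum)
qed

lemma cube_sum_signs:
  assumes "finite C" "\<forall>e\<in>C. s e \<in> {1, -1 :: int}"
  shows "(\<Sum>e\<in>C. s e) ^ 3 = (3 * int (card C) - 2) * (\<Sum>e\<in>C. s e) + 6 * esym 3 C s"
  using assms
proof (induction C rule: finite_induct)
  case empty
  then show ?case using esym_empty[of 2] by (simp add: numeral_3_eq_3)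
next
  case (insert x C)
  define y where "y = (\<Sum>e\<in>C. s e)"
  have x: "s x \<in> {1, -1}" using insert.prems by auto
  have e3: "esym 3 (insert x C) s = esym 3 C s + s x * esym 2 C s"
    using esym_insert[OF insert.hyps, of 2] by (simp add: numeral_3_eq_3 numeral_2_eq_2)
  have e2: "2 * esym 2 C s = y\<^sup>2 - int (card C)"
    using square_sum_signs[OF insert.hyps(1)] insert.prems by (simp add: y_def)
  have IH: "y ^ 3 = (3 * int (card C) - 2) * y + 6 * esym 3 C s"
    using insert by (simp add: y_def)
  have "(s x + y) ^ 3 = y ^ 3 + 3 * s x * y\<^sup>2 + 3 * y + s x"
    using x by (auto simp: power3_eq_cube power2_eq_square algebra_simps)
  also have "\<dots> = (3 * int (card C) + 1) * (s x + y) + 6 * (esym 3 C s + s x * esym 2 C s)"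
    using x e2 IH by (auto simp: algebra_simps)
  finally show ?case using insert.hyps e3 by (simp add: y_def algebra_simps)
qed

text \<open>The total \<open>t\<close> of the eight signs satisfies \<open>t\<^sup>3 = 4t\<close>, while Newton's identity reads
  \<open>t\<^sup>3 = 22t + 6e\<^sub>3\<close>, so \<open>e\<^sub>3 + 3t = 0\<close>. The sign \<open>c\<close> is kept apart because in the application
  it is constant on the family, which lowers the degree of every term that contains it.\<close>

lemma cubic_relation_of_balanced_signs:
  assumes "finite C" "card C = 7" "\<forall>e\<in>C. s e \<in> {1, -1 :: int}" "c \<in> {1, -1}"
    and "c + (\<Sum>e\<in>C. s e) \<in> {-2, 0, 2}"
  shows "esym 3 C s + c * esym 2 C s + 3 * esym 1 C s + 3 * c * esym 0 C s = 0"
proof -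
  define y where "y = (\<Sum>e\<in>C. s e)"
  have e0: "esym 0 C s = 1" and e1: "esym 1 C s = y"
    using esym_0[of C s] esym_1[of C s] assms(1) by (simp_all add: y_def)
  have e2: "y\<^sup>2 = 7 + 2 * esym 2 C s" and e3: "y ^ 3 = 19 * y + 6 * esym 3 C s"
    using square_sum_signs[of C s] cube_sum_signs[of C s] assms by (simp_all add: y_def)
  have "y \<in> {-2 - c, - c, 2 - c}" using assms(5) by (auto simp: y_def)
  then consider "c = 1" "y = -3" | "c = 1" "y = -1" | "c = 1" "y = 1"
    | "c = -1" "y = -1" | "c = -1" "y = 1" | "c = -1" "y = 3"
    using assms(4) by auto
  then show ?thesis unfolding e0 e1 using e2 e3 by cases simp_all
qed

section \<open>Characters on families of sets\<close>

definition flip :: "'a set \<Rightarrow> 'a \<Rightarrow> int" where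
  "flip R e = (if e \<in> R then -1 else 1)"

text \<open>The squarefree monomial with index set \<open>T\<close> in the sign variables \<open>flip R e\<close>.\<close>

definition character :: "'a set \<Rightarrow> 'a set \<Rightarrow> int" where
  "character T R = (\<Prod>e\<in>T. flip R e)"

lemma flip_cases: "flip R e \<in> {1, -1}"
  by (simp add: flip_def)

lemma character_mult:
  assumes "finite S" "finite T"
  shows "character S R * character T R = character ((S - T) \<union> (T - S)) R"
proof -
  have sq: "character (S \<inter> T) R * character (S \<inter> T) R = 1"
    unfolding character_def prod.distrib[symmetric] by (intro prod.neutral) (simp add: flip_def)
  have S: "character S R = character (S \<inter> T) R * character (S - T) R"
    unfolding character_def using assms(1) by (rule prod.Int_Diff)
  have T: "character T R = character (S \<inter> T) R * character (T - S) R"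
    unfolding character_def using prod.Int_Diff[OF assms(2), of _ S] by (simp add: Int_commute)
  have "character ((S - T) \<union> (T - S)) R = character (S - T) R * character (T - S) R"
    unfolding character_def using assms by (intro prod.union_disjoint) auto
  moreover have "character S R * character T R = (character (S \<inter> T) R * character (S \<inter> T) R) *
      (character (S - T) R * character (T - S) R)"
    unfolding S T by (simp only: ac_simps)
  ultimately show ?thesis using sq by simp
qed

lemma character_orthogonality:
  assumes "finite E" "Q \<subseteq> E" "R \<subseteq> E"
  shows "(\<Sum>T\<in>Pow E. character T Q * character T R) = (if Q = R then 2 ^ card E else 0)"
proof -
  have "(\<Sum>T\<in>Pow E. character T Q * character T R) = (\<Prod>e\<in>E. flip Q e * flip R e + 1)"
    using prod_add[of E "\<lambda>e. flip Q e * flip R e" "\<lambda>_. 1"] assms(1)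
    by (simp add: character_def prod.distrib)
  also have "\<dots> = (if Q = R then 2 ^ card E else 0)"
  proof (cases "Q = R")
    case True
    then have "flip Q e * flip R e + 1 = 2" for e by (simp add: flip_def)
    then show ?thesis using True by simp
  next
    case False
    then obtain e where e: "e \<in> E" "e \<in> Q \<longleftrightarrow> e \<notin> R" using assms(2,3) by blast
    then have "flip Q e * flip R e + 1 = 0" by (auto simp: flip_def)
    then have "(\<Prod>e\<in>E. flip Q e * flip R e + 1) = 0" using e(1) assms(1) by (intro prod_zero) auto
    then show ?thesis using False by simp
  qed
  finally show ?thesis .
qed

lemma characters_separate:
  assumes "finite E" "\<F> \<subseteq> Pow E"
    and orth: "\<And>T. T \<subseteq> E \<Longrightarrow> (\<Sum>R\<in>\<F>. g R * character T R) = 0"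
    and "Q \<in> \<F>"
  shows "g Q = 0"
proof -
  have fin: "finite \<F>" using assms(1,2) finite_subset by blast
  have "0 = (\<Sum>T\<in>Pow E. character T Q * (\<Sum>R\<in>\<F>. g R * character T R))"
    using orth by simp
  also have "\<dots> = (\<Sum>R\<in>\<F>. g R * (\<Sum>T\<in>Pow E. character T Q * character T R))"
    unfolding sum_distrib_left by (subst sum.swap) (simp only: mult.left_commute)
  also have "\<dots> = (\<Sum>R\<in>\<F>. g R * (if Q = R then 2 ^ card E else 0))"
    using assms(1,2,4) by (intro sum.cong refl arg_cong2[where f = "(*)"] character_orthogonality) auto
  also have "\<dots> = (\<Sum>R\<in>\<F>. if R = Q then g Q * 2 ^ card E else 0)"
    by (intro sum.cong) auto
  also have "\<dots> = g Q * 2 ^ card E"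
    using fin assms(4) by simp
  finally show ?thesis by simp
qed

section \<open>Families with balanced signed sums\<close>

lemma card_subsets_between:
  assumes "finite U" "A \<subseteq> U" "card A \<le> k"
  shows "card {C. A \<subseteq> C \<and> C \<subseteq> U \<and> card C = k} = (card U - card A) choose (k - card A)"
proof -
  have fA: "finite A" using assms finite_subset by blast
  have "bij_betw (\<lambda>D. A \<union> D) {D. D \<subseteq> U - A \<and> card D = k - card A}
    {C. A \<subseteq> C \<and> C \<subseteq> U \<and> card C = k}"
  proof (rule bij_betw_byWitness[where f' = "\<lambda>C. C - A"])
    show "\<forall>D\<in>{D. D \<subseteq> U - A \<and> card D = k - card A}. A \<union> D - A = D" by blast
    show "\<forall>C\<in>{C. A \<subseteq> C \<and> C \<subseteq> U \<and> card C = k}. A \<union> (C - A) = C" by blast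
    show "(\<lambda>D. A \<union> D) ` {D. D \<subseteq> U - A \<and> card D = k - card A} \<subseteq>
        {C. A \<subseteq> C \<and> C \<subseteq> U \<and> card C = k}"
    proof (intro image_subsetI CollectI conjI; elim CollectE conjE)
      fix D assume D: "D \<subseteq> U - A" "card D = k - card A"
      have "finite D" using D(1) assms(1) finite_subset[OF D(1)] by simp
      moreover have "A \<inter> D = {}" using D(1) by blast
      ultimately show "card (A \<union> D) = k" using D(2) fA assms(3) by (simp add: card_Un_disjoint)
      show "A \<subseteq> A \<union> D" "A \<union> D \<subseteq> U" using D(1) assms(2) by blast+
    qed
    show "(\<lambda>C. C - A) ` {C. A \<subseteq> C \<and> C \<subseteq> U \<and> card C = k} \<subseteq>
        {D. D \<subseteq> U - A \<and> card D = k - card A}"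
    proof (intro image_subsetI CollectI conjI; elim CollectE conjE)
      fix C assume C: "A \<subseteq> C" "C \<subseteq> U" "card C = k"
      show "C - A \<subseteq> U - A" using C(2) by blast
      show "card (C - A) = k - card A" using C fA by (simp add: card_Diff_subset)
    qed
  qed
  then have "card {C. A \<subseteq> C \<and> C \<subseteq> U \<and> card C = k} =
      card {D. D \<subseteq> U - A \<and> card D = k - card A}"
    by (rule bij_betw_same_card[symmetric])
  also have "\<dots> = card (U - A) choose (k - card A)" using assms by (simp add: n_subsets)
  finally show ?thesis using assms fA by (simp add: card_Diff_subset)
qed

text \<open>Multiplying the relation of \<open>C\<close> by its coefficient at \<open>P\<close> and adding over all 7-sets \<open>C\<close>
  with \<open>P \<subseteq> C \<subseteq> U\<close>, \<open>|U| = 10\<close>, gives an equation in which \<open>\<mu> S\<close> has as coefficient a sum of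
  \<open>(10 - |P \<union> S|) choose (7 - |P \<union> S|)\<close> signs. This number is odd for \<open>S = P\<close> and even otherwise,
  so the system is the identity modulo 2.\<close>

lemma triples_determined_by_signed_sums:
  fixes \<mu> :: "'a set \<Rightarrow> int"
  assumes "finite E" "10 \<le> card E"
    and signs: "\<And>C e. C \<subseteq> E \<Longrightarrow> card C = 7 \<Longrightarrow> e \<in> C \<Longrightarrow> X C e \<in> {1, -1 :: int}"
    and rel: "\<And>C. C \<subseteq> E \<Longrightarrow> card C = 7 \<Longrightarrow>
      (\<Sum>T | T \<subseteq> C \<and> card T = 3. (\<Prod>e\<in>T. X C e) * \<mu> T) = 0"
    and T: "T \<subseteq> E" "card T = 3"
  shows "\<mu> T = 0"
proof -
  obtain U where U: "T \<subseteq> U" "U \<subseteq> E" "card U = 10"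
    using exists_subset_between[of T 10 E] assms by auto
  have fU: "finite U" using U(2) assms(1) finite_subset by blast
  define x where "x C S = (\<Prod>e\<in>S. X C e)" for C S
  define I where "I = {S. S \<subseteq> U \<and> card S = 3}"
  define CC where "CC P = {C. P \<subseteq> C \<and> C \<subseteq> U \<and> card C = 7}" for P
  define w where "w P S = (\<Sum>C\<in>CC (P \<union> S). x C P * x C S)" for P S
  have fI: "finite I" and fCC: "finite (CC P)" for P using fU by (simp_all add: I_def CC_def)
  have x_sign: "x C S \<in> {1, -1}" if "C \<in> CC P" "S \<subseteq> C" for C P S
  proof -
    have C: "C \<subseteq> E" "card C = 7" "finite S"
      using that U(2) finite_subset[OF _ fU] by (auto simp: CC_def)
    show ?thesis
      unfolding x_def using C(3) that(2) by (intro prod_sign ballI signs[OF C(1,2)]) auto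
  qed
  have parity: "even (w P S) \<longleftrightarrow> P \<noteq> S" if PS: "P \<in> I" "S \<in> I" for P S
  proof -
    have fin: "finite P" "finite S" using PS fU finite_subset unfolding I_def by blast+
    have "odd (x C P * x C S)" if "C \<in> CC (P \<union> S)" for C
      using x_sign[OF that, of P] x_sign[OF that, of S] that by (auto simp: CC_def)
    then have "{C \<in> CC (P \<union> S). odd (x C P * x C S)} = CC (P \<union> S)" by blast
    then have "even (w P S) \<longleftrightarrow> even (card (CC (P \<union> S)))"
      using fCC by (simp add: w_def even_sum_iff)
    moreover have "card (P \<union> S) \<le> 6" using card_Un_le[of P S] PS by (simp add: I_def)
    moreover from this have "card (CC (P \<union> S)) = (10 - card (P \<union> S)) choose (7 - card (P \<union> S))"
      using card_subsets_between[of U "P \<union> S" 7] fU U PS by (simp add: CC_def I_def)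
    moreover have "card (P \<union> S) \<ge> 3" "card (P \<union> S) = 3 \<longleftrightarrow> P = S"
    proof -
      show "card (P \<union> S) \<ge> 3" using card_mono[of "P \<union> S" P] fin PS by (simp add: I_def)
      show "card (P \<union> S) = 3 \<longleftrightarrow> P = S"
        using card_subset_eq[of "P \<union> S" P] card_subset_eq[of "P \<union> S" S] fin PS
        by (auto simp: I_def)
    qed
    moreover from calculation have "card (P \<union> S) \<in> {3, 4, 5, 6}" by auto
    moreover have "7 choose 4 = (35::nat)" "6 choose 3 = (20::nat)" "5 choose 2 = (10::nat)"
      "4 choose 1 = (4::nat)"
      by (simp_all add: binomial_Suc_Suc numeral_eq_Suc)
    ultimately show ?thesis by (elim insertE emptyE) simp_all
  qed
  have "(\<Sum>S\<in>I. w P S * \<mu> S) = 0" if "P \<in> I" for P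
  proof -
    have "(\<Sum>S\<in>I. w P S * \<mu> S) =
        (\<Sum>S\<in>I. \<Sum>C | C \<in> CC P \<and> S \<subseteq> C. x C P * (x C S * \<mu> S))"
      unfolding w_def sum_distrib_right
      by (intro sum.cong) (auto simp: CC_def ac_simps)
    also have "\<dots> = (\<Sum>C\<in>CC P. \<Sum>S | S \<in> I \<and> S \<subseteq> C. x C P * (x C S * \<mu> S))"
      using fI fCC by (intro sum.swap_restrict)
    also have "\<dots> = (\<Sum>C\<in>CC P. x C P * (\<Sum>S | S \<subseteq> C \<and> card S = 3. x C S * \<mu> S))"
      unfolding sum_distrib_left by (intro sum.cong) (auto simp: CC_def I_def)
    also have "\<dots> = 0"
      using rel U(2) by (intro sum.neutral) (auto simp: CC_def x_def)
    finally show ?thesis .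
  qed
  then show ?thesis
    using identity_mod_2_nonsingular[of I w \<mu> T] parity fI T U by (auto simp: I_def)
qed


text \<open>For a function \<open>g\<close> on the family, the moments are the inner products of \<open>g\<close> with the
  characters.\<close>

lemma moment_of_esym:
  assumes "finite C"
  shows "(\<Sum>R\<in>\<F>. g R * esym k C (\<lambda>e. x e * flip R e)) =
    (\<Sum>T | T \<subseteq> C \<and> card T = k. (\<Prod>e\<in>T. x e) * (\<Sum>R\<in>\<F>. g R * character T R))"
  unfolding esym_def sum_distrib_left
  by (subst sum.swap) (simp add: character_def prod.distrib mult.left_commute)

text \<open>In the application \<open>E\<close> consists of all elements except \<open>l\<close>, the signs \<open>X C\<close> are those of a
  circuit with support \<open>C \<union> {l}\<close>, and \<open>c C\<close> is its sign at \<open>l\<close>.\<close>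

context
  fixes E :: "'a set" and \<F> :: "'a set set"
    and X :: "'a set \<Rightarrow> 'a \<Rightarrow> int" and c :: "'a set \<Rightarrow> int"
  assumes finite_E: "finite E" and card_E: "10 \<le> card E"
    and family: "\<F> \<subseteq> Pow E"
    and signs: "\<And>C e. C \<subseteq> E \<Longrightarrow> card C = 7 \<Longrightarrow> e \<in> C \<Longrightarrow> X C e \<in> {1, -1}"
    and sign_last: "\<And>C. C \<subseteq> E \<Longrightarrow> card C = 7 \<Longrightarrow> c C \<in> {1, -1}"
    and balanced: "\<And>C R. C \<subseteq> E \<Longrightarrow> card C = 7 \<Longrightarrow> R \<in> \<F> \<Longrightarrow>
      c C + (\<Sum>e\<in>C. X C e * flip R e) \<in> {-2, 0, 2}"
begin

lemma moments_of_triples_vanish: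
  assumes low: "\<And>S. S \<subseteq> E \<Longrightarrow> card S \<le> 2 \<Longrightarrow> (\<Sum>R\<in>\<F>. g R * character S R) = 0"
    and T: "T \<subseteq> E" "card T = 3"
  shows "(\<Sum>R\<in>\<F>. g R * character T R) = 0"
proof (rule triples_determined_by_signed_sums[where X = X, OF finite_E card_E signs _ T])
  fix C assume C: "C \<subseteq> E" "card C = 7"
  have fC: "finite C" using C(1) finite_E finite_subset by blast
  define M where "M k = (\<Sum>R\<in>\<F>. g R * esym k C (\<lambda>e. X C e * flip R e))" for k
  have M_low: "M k = 0" if "k \<le> 2" for k
    unfolding M_def moment_of_esym[OF fC] using low C(1) that by (intro sum.neutral) auto
  have "0 = (\<Sum>R\<in>\<F>. g R * (esym 3 C (\<lambda>e. X C e * flip R e)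
      + c C * esym 2 C (\<lambda>e. X C e * flip R e) + 3 * esym 1 C (\<lambda>e. X C e * flip R e)
      + 3 * c C * esym 0 C (\<lambda>e. X C e * flip R e)))"
  proof (rule sum.neutral[symmetric], intro ballI)
    fix R assume R: "R \<in> \<F>"
    have "X C e * flip R e \<in> {1, -1}" if "e \<in> C" for e
      using signs[OF C that] flip_cases[of R e] by auto
    then show "g R * (esym 3 C (\<lambda>e. X C e * flip R e)
      + c C * esym 2 C (\<lambda>e. X C e * flip R e) + 3 * esym 1 C (\<lambda>e. X C e * flip R e)
      + 3 * c C * esym 0 C (\<lambda>e. X C e * flip R e)) = 0"
      using cubic_relation_of_balanced_signs[OF fC C(2), of "\<lambda>e. X C e * flip R e" "c C"]
        sign_last[OF C] balanced[OF C R] by simp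
  qed
  also have "\<dots> = M 3 + c C * M 2 + 3 * M 1 + 3 * c C * M 0"
    unfolding M_def sum_distrib_left sum.distrib[symmetric]
    by (intro sum.cong refl) (simp only: algebra_simps)
  also have "\<dots> = M 3" using M_low by simp
  finally show "(\<Sum>T | T \<subseteq> C \<and> card T = 3.
      (\<Prod>e\<in>T. X C e) * (\<Sum>R\<in>\<F>. g R * character T R)) = 0"
    unfolding M_def moment_of_esym[OF fC] by simp
qed

text \<open>A monomial of degree \<open>d > 2\<close> is a cubic monomial times one, \<open>W\<close>, of degree \<open>d - 3\<close>. Twisting
  \<open>g\<close> by \<open>W\<close> turns its moments of degree at most 2 into moments of \<open>g\<close> of degree at
  most \<open>d - 1\<close>, which vanish by induction, so the result on triples applies to the twisted
  function.\<close>

lemma all_moments_vanish: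
  assumes low: "\<And>S. S \<subseteq> E \<Longrightarrow> card S \<le> 2 \<Longrightarrow> (\<Sum>R\<in>\<F>. g R * character S R) = 0"
    and "T \<subseteq> E"
  shows "(\<Sum>R\<in>\<F>. g R * character T R) = 0"
  using assms(2)
proof (induction "card T" arbitrary: T rule: less_induct)
  case less
  have fT: "finite T" using less.prems finite_E finite_subset by blast
  show ?case
  proof (cases "card T \<le> 2")
    case False
    then obtain S where S: "S \<subseteq> T" "card S = 3"
      using obtain_subset_with_card_n[of 3 T] by auto
    define W where "W = T - S"
    have fin: "finite S" "finite W" using S(1) fT finite_subset by (auto simp: W_def)
    have card_W: "card W + 3 = card T"
      using S fT card_mono[OF fT S(1)] by (simp add: W_def card_Diff_subset fin)
    have "(\<Sum>R\<in>\<F>. (g R * character W R) * character S R) = 0"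
    proof (rule moments_of_triples_vanish)
      fix P assume P: "P \<subseteq> E" "card P \<le> 2"
      let ?D = "(W - P) \<union> (P - W)"
      have fP: "finite P" using P(1) finite_E finite_subset by blast
      have "card ?D \<le> card W + card P"
        using card_Un_le[of "W - P" "P - W"] card_mono[OF fin(2), of "W - P"] card_mono[OF fP, of "P - W"]
        by (simp add: Diff_subset)
      then have "card ?D < card T" using card_W P(2) by simp
      moreover have "?D \<subseteq> E" using P(1) less.prems by (auto simp: W_def)
      ultimately have "(\<Sum>R\<in>\<F>. g R * character ?D R) = 0" by (rule less.hyps)
      then show "(\<Sum>R\<in>\<F>. g R * character W R * character P R) = 0"
        by (simp only: mult.assoc character_mult[OF fin(2) fP])
    qed (use S less.prems in auto)
    moreover have "(W - S) \<union> (S - W) = T" using S(1) by (auto simp: W_def)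
    ultimately show ?thesis
      by (simp only: mult.assoc character_mult[OF fin(2) fin(1)])
  qed (use low less.prems in auto)
qed

text \<open>If there were more members than monomials of degree at most 2, some nonzero \<open>g\<close> would be
  orthogonal to all these monomials, hence to all monomials, hence zero.\<close>

lemma card_balanced_family: "card \<F> \<le> card {S. S \<subseteq> E \<and> card S \<le> 2}"
proof (rule ccontr)
  assume "\<not> ?thesis"
  moreover have fin: "finite \<F>" "finite {S. S \<subseteq> E \<and> card S \<le> 2}"
    using family finite_E finite_subset by auto
  ultimately obtain g where g: "\<exists>R\<in>\<F>. g R \<noteq> 0"
    "\<forall>S\<in>{S. S \<subseteq> E \<and> card S \<le> 2}. (\<Sum>R\<in>\<F>. character S R * g R) = 0"
    using homogeneous_system_nontrivial[of "{S. S \<subseteq> E \<and> card S \<le> 2}" \<F> character] by auto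
  have "(\<Sum>R\<in>\<F>. g R * character S R) = 0" if "S \<subseteq> E" "card S \<le> 2" for S
    using g(2) that by (simp add: mult.commute)
  then have "(\<Sum>R\<in>\<F>. g R * character T R) = 0" if "T \<subseteq> E" for T
    using all_moments_vanish that by blast
  then have "g R = 0" if "R \<in> \<F>" for R
    using characters_separate[OF finite_E family _ that] by blast
  then show False using g(1) by blast
qed

end

section \<open>Neighborly reorientations\<close>

lemma neighborly_2_iff_sum:
  fixes Y :: "'a \<Rightarrow> int"
  assumes vals: "\<And>e. Y e \<in> {-1, 0, 1}" and card: "card (support Y) = 8"
  shows "card (pos_part Y) > 2 \<and> card (neg_part Y) > 2 \<longleftrightarrow> (\<Sum>e\<in>support Y. Y e) \<in> {-2, 0, 2}"
proof -
  have fin: "finite (pos_part Y)" "finite (neg_part Y)"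
    using card card.infinite[of "support Y"] by (auto simp: support_def)
  have disj: "pos_part Y \<inter> neg_part Y = {}" by (auto simp: pos_part_def neg_part_def)
  have "card (pos_part Y) + card (neg_part Y) = 8"
    using card card_Un_disjoint[OF fin disj] by (simp add: support_def)
  moreover have "(\<Sum>e\<in>support Y. Y e) = int (card (pos_part Y)) - int (card (neg_part Y))"
  proof -
    have "(\<Sum>e\<in>pos_part Y. Y e) = int (card (pos_part Y))"
      by (simp add: pos_part_def)
    moreover have "(\<Sum>e\<in>neg_part Y. Y e) = - int (card (neg_part Y))"
      by (simp add: neg_part_def)
    ultimately show ?thesis
      unfolding support_def using sum.union_disjoint[OF fin disj, of Y] by simp
  qed
  moreover have "2 < p \<and> 2 < q \<longleftrightarrow> int p - int q \<in> {-2, 0, 2}" if "p + q = 8" for p q :: nat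
    unfolding insert_iff empty_iff using that by presburger
  ultimately show ?thesis by simp
qed

lemma support_flip: "support (\<lambda>e. X e * flip R e) = support X"
  by (auto simp: support_def pos_part_def neg_part_def flip_def)

lemma neighborly_2_reorient_iff:
  assumes "circuits M \<subseteq> sign_vectors (ground M)" "\<And>X. X \<in> circuits M \<Longrightarrow> card (support X) = 8"
  shows "neighborly 2 (reorient R M) \<longleftrightarrow>
    (\<forall>X\<in>circuits M. (\<Sum>e\<in>support X. X e * flip R e) \<in> {-2, 0, 2})"
proof -
  have "circuits (reorient R M) = (\<lambda>X e. X e * flip R e) ` circuits M"
    unfolding reorient_def signed_system.simps by (intro image_cong refl) (auto simp: flip_def)
  moreover have "card (pos_part (\<lambda>e. X e * flip R e)) > 2 \<and> card (neg_part (\<lambda>e. X e * flip R e)) > 2 \<longleftrightarrow>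
      (\<Sum>e\<in>support X. X e * flip R e) \<in> {-2, 0, 2}" if X: "X \<in> circuits M" for X
  proof -
    have "X e * flip R e \<in> {-1, 0, 1}" for e
      using X assms(1) by (auto simp: sign_vectors_def flip_def)
    then show ?thesis
      using neighborly_2_iff_sum[of "\<lambda>e. X e * flip R e"] assms(2)[OF X] by (simp add: support_flip)
  qed
  ultimately show ?thesis unfolding neighborly_def by auto
qed

text \<open>Reorienting all elements negates every circuit, which swaps positive and negative parts.\<close>

lemma neighborly_reorient_complement:
  assumes "circuits M \<subseteq> sign_vectors (ground M)"
  shows "neighborly k (reorient (ground M - R) M) \<longleftrightarrow> neighborly k (reorient R M)"
proof -
  have zero: "X e = 0" if "X \<in> circuits M" "e \<notin> ground M" for X e
    using assms that by (auto simp: sign_vectors_def)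
  have "(\<lambda>e. if e \<in> ground M - R then - X e else X e) = (\<lambda>e. - (if e \<in> R then - X e else X e))"
    if "X \<in> circuits M" for X
    using zero[OF that] by (intro ext) auto
  moreover have "pos_part (\<lambda>e. - Y e) = neg_part Y" "neg_part (\<lambda>e. - Y e) = pos_part Y" for Y :: "'a \<Rightarrow> int"
    by (auto simp: pos_part_def neg_part_def)
  ultimately show ?thesis by (auto simp: neighborly_def reorient_def simp del: if_split)
qed

lemma num_neighborly_reorientations_eq_twice:
  assumes "circuits M \<subseteq> sign_vectors (ground M)" "finite (ground M)" "l \<in> ground M"
  shows "num_neighborly_reorientations M k =
    2 * card {R. R \<subseteq> ground M - {l} \<and> neighborly k (reorient R M)}"
proof -
  let ?N = "\<lambda>R. neighborly k (reorient R M)"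
  let ?F = "{R. R \<subseteq> ground M - {l} \<and> ?N R}"
  let ?c = "\<lambda>R. ground M - R"
  have compl: "?N (?c R) \<longleftrightarrow> ?N R" for R using assms(1) by (rule neighborly_reorient_complement)
  have "{R. R \<subseteq> ground M \<and> ?N R} = ?F \<union> ?c ` ?F"
  proof (intro set_eqI iffI)
    fix R assume R: "R \<in> {R. R \<subseteq> ground M \<and> ?N R}"
    show "R \<in> ?F \<union> ?c ` ?F"
    proof (cases "l \<in> R")
      case True
      have "R = ?c (?c R)" using R by blast
      moreover have "?c R \<in> ?F" using True R compl by auto
      ultimately show ?thesis by blast
    qed (use R in auto)
  qed (use compl in auto)
  moreover have "?F \<inter> ?c ` ?F = {}" using assms(3) by auto
  moreover have "card (?c ` ?F) = card ?F"
    by (intro card_image inj_onI) blast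
  moreover have "finite ?F" using assms(2) by simp
  ultimately show ?thesis
    unfolding num_neighborly_reorientations_def by (simp add: card_Un_disjoint)
qed

lemma card_neighborly_reorientations_le:
  assumes sv: "circuits M \<subseteq> sign_vectors (ground M)" and fin: "finite (ground M)"
    and sup: "support ` circuits M = {J. J \<subseteq> ground M \<and> card J = 8}"
    and card: "11 \<le> card (ground M)" and l: "l \<in> ground M"
  shows "num_neighborly_reorientations M 2 \<le> 2 * card {S. S \<subseteq> ground M - {l} \<and> card S \<le> 2}"
proof -
  let ?E = "ground M - {l}"
  let ?F = "{R. R \<subseteq> ?E \<and> neighborly 2 (reorient R M)}"
  have "\<exists>X\<in>circuits M. support X = insert l C" if "C \<subseteq> ?E" "card C = 7" for C
  proof -
    have "finite C" using that(1) fin finite_subset by blast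
    moreover have "l \<notin> C" using that(1) by blast
    ultimately have "insert l C \<in> support ` circuits M" unfolding sup using that l by auto
    then show ?thesis by auto
  qed
  then have "\<forall>C. \<exists>X. C \<subseteq> ?E \<and> card C = 7 \<longrightarrow> X \<in> circuits M \<and> support X = insert l C"
    by blast
  then obtain X where "\<forall>C. C \<subseteq> ?E \<and> card C = 7 \<longrightarrow> X C \<in> circuits M \<and> support (X C) = insert l C"
    unfolding choice_iff by (elim exE)
  then have X: "X C \<in> circuits M" "support (X C) = insert l C" if "C \<subseteq> ?E" "card C = 7" for C
    using that by simp_all
  have nonzero: "X C e \<in> {1, -1}" if "C \<subseteq> ?E" "card C = 7" "e \<in> insert l C" for C e
  proof -
    have "e \<in> support (X C)" using X(2)[OF that(1,2)] that(3) by simp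
    then show ?thesis by (auto simp: support_def pos_part_def neg_part_def)
  qed
  have "card ?F \<le> card {S. S \<subseteq> ?E \<and> card S \<le> 2}"
  proof (rule card_balanced_family[where X = X and c = "\<lambda>C. X C l"])
    show "10 \<le> card ?E" using card fin l by simp
    show "X C e \<in> {1, -1}" if "C \<subseteq> ?E" "card C = 7" "e \<in> C" for C e
      using nonzero that by blast
    show "X C l \<in> {1, -1}" if "C \<subseteq> ?E" "card C = 7" for C
      using nonzero that by blast
    show "finite ?E" using fin by simp
    show "?F \<subseteq> Pow ?E" by blast
    fix C R assume C: "C \<subseteq> ?E" "card C = 7" and R: "R \<in> ?F"
    have "card (support Y) = 8" if "Y \<in> circuits M" for Y
      using imageI[OF that, of support] unfolding sup by simp
    then have bal: "\<forall>Y\<in>circuits M. (\<Sum>e\<in>support Y. Y e * flip R e) \<in> {-2, 0, 2}"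
      using R neighborly_2_reorient_iff[OF sv, of R] by blast
    have "(\<Sum>e\<in>insert l C. X C e * flip R e) \<in> {-2, 0, 2}"
      using bspec[OF bal X(1)[OF C]] unfolding X(2)[OF C] .
    moreover have "finite C" using C(1) fin finite_subset by blast
    moreover have "l \<notin> C" using C(1) by blast
    moreover have "flip R l = 1" using R by (auto simp: flip_def)
    ultimately show "X C l + (\<Sum>e\<in>C. X C e * flip R e) \<in> {-2, 0, 2}"
      by simp
  qed
  then show ?thesis
    unfolding num_neighborly_reorientations_eq_twice[OF sv fin l] by simp
qed

section \<open>The alternating oriented matroid\<close>

text \<open>The condition \<open>j i \<le> b\<close> cuts out an initial segment of the indices, and the initial sums
  of an alternating sequence are alternately \<open>x 1\<close> and 0.\<close>

lemma alternating_sum_initial: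
  fixes x :: "nat \<Rightarrow> int" and j :: "nat \<Rightarrow> nat"
  assumes "strict_mono_on {1..m} j" "\<And>i. i \<in> {1..<m} \<Longrightarrow> x i = - x (i + 1)"
  shows "(\<Sum>i | i \<in> {1..m} \<and> j i \<le> b. x i) \<in> {0, x 1}"
proof -
  have full: "(\<Sum>i\<in>{1..k}. x i) = (if odd k then x 1 else 0) \<and> (1 \<le> k \<longrightarrow> x k = (if odd k then x 1 else - x 1))"
    if "k \<le> m" for k
    using that
  proof (induction k)
    case (Suc k)
    show ?case
    proof (cases "k = 0")
      case False
      then have "x (Suc k) = - x k" using assms(2)[of k] Suc.prems by auto
      then show ?thesis using Suc False by auto
    qed auto
  qed auto
  have "\<exists>k\<le>m. {i. i \<in> {1..m} \<and> j i \<le> b} = {1..k}"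
    using assms(1)
  proof (induction m)
    case (Suc m)
    show ?case
    proof (cases "j (Suc m) \<le> b")
      case True
      have "j i \<le> b" if "i \<in> {1..Suc m}" for i
        using strict_mono_on_leD[OF Suc.prems, of i "Suc m"] that True by auto
      then show ?thesis by (intro exI[of _ "Suc m"]) auto
    next
      case False
      have "strict_mono_on {1..m} j"
        using Suc.prems by (rule monotone_on_subset) auto
      then obtain k where "k \<le> m" "{i. i \<in> {1..m} \<and> j i \<le> b} = {1..k}" using Suc.IH by blast
      moreover have "{i. i \<in> {1..Suc m} \<and> j i \<le> b} = {i. i \<in> {1..m} \<and> j i \<le> b}"
        using False le_Suc_eq by auto
      ultimately show ?thesis by (intro exI[of _ k]) auto
    qed
  qed auto
  then obtain k where k: "k \<le> m" and initial: "{i. i \<in> {1..m} \<and> j i \<le> b} = {1..k}" by blast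
  show ?thesis unfolding initial using full[OF k] by simp
qed

text \<open>The signs of a circuit cancel in total, so after reorientation they add up to \<open>-2\<close> times the
  sum over the elements in the interval. That sum runs over a block of consecutive elements of
  the support, where alternating signs add up to \<open>-1\<close>, 0 or 1.\<close>

lemma interval_reorientation_neighborly:
  "neighborly 2 (reorient {a..b} (alternating_om 7 n))"
proof -
  let ?M = "alternating_om 7 n"
  have sup: "\<exists>j :: nat \<Rightarrow> nat. strict_mono_on {1..8} j \<and> support X = j ` {1..8} \<and> (\<forall>i\<in>{1..7}. X (j i) = - X (j (i + 1)))"
    if "X \<in> circuits ?M" for X
    using that by (auto simp: alternating_om_def)
  have "card (support X) = 8" if "X \<in> circuits ?M" for X
    using sup[OF that] strict_mono_on_imp_inj_on card_image by fastforce
  moreover have "circuits ?M \<subseteq> sign_vectors (ground ?M)" by (auto simp: alternating_om_def)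
  moreover have "(\<Sum>e\<in>support X. X e * flip {a..b} e) \<in> {-2, 0, 2}" if X: "X \<in> circuits ?M" for X
  proof -
    obtain j :: "nat \<Rightarrow> nat" where j: "strict_mono_on {1..8} j" "support X = j ` {1..8}"
      "\<forall>i\<in>{1..7}. X (j i) = - X (j (i + 1))"
      using sup[OF X] by blast
    define x where "x i = X (j i)" for i
    define P where "P b = (\<Sum>i | i \<in> {1..8} \<and> j i \<le> b. x i)" for b
    have alt: "x i = - x (i + 1)" if "i \<in> {1..<8}" for i using j(3) that by (auto simp: x_def)
    have P: "P b \<in> {0, x 1}" for b
      unfolding P_def by (rule alternating_sum_initial[OF j(1)]) (use alt in auto)
    have x1: "x 1 \<in> {1, -1}"
    proof -
      have "j 1 \<in> support X" using j(2) by auto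
      then show ?thesis by (auto simp: x_def support_def pos_part_def neg_part_def)
    qed
    have total: "(\<Sum>i\<in>{1..8}. x i) = 0"
      using alt[of 1] alt[of 3] alt[of 5] alt[of 7] by (simp add: numeral_eq_Suc)
    define B where "B = (\<Sum>i | i \<in> {1..8} \<and> a \<le> j i \<and> j i \<le> b. x i)"
    have "B \<in> {-1, 0, 1}"
    proof -
      consider "a = 0" | "b < a" | "0 < a" "a \<le> b" by linarith
      then show ?thesis
      proof cases
        \<comment> \<open>Separate because \<open>a - 1\<close> below is truncated.\<close>
        case 1
        then show ?thesis using P[of b] x1 by (auto simp: B_def P_def)
      next
        case 2
        have "B = 0" unfolding B_def by (rule sum.neutral) (use 2 in auto)
        then show ?thesis by simp
      next
        case 3
        have "{i. i \<in> {1..8} \<and> j i \<le> b} =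
            {i. i \<in> {1..8} \<and> j i \<le> a - 1} \<union> {i. i \<in> {1..8} \<and> a \<le> j i \<and> j i \<le> b}"
          using 3 by auto
        moreover have "{i. i \<in> {1..8} \<and> j i \<le> a - 1} \<inter> {i. i \<in> {1..8} \<and> a \<le> j i \<and> j i \<le> b} = {}"
          using 3 by auto
        ultimately have "P b = P (a - 1) + B"
          unfolding P_def B_def by (simp add: sum.union_disjoint)
        then show ?thesis using P[of b] P[of "a - 1"] x1 by auto
      qed
    qed
    moreover have "(\<Sum>e\<in>support X. X e * flip {a..b} e) = - 2 * B"
    proof -
      have "(\<Sum>e\<in>support X. X e * flip {a..b} e) = (\<Sum>i\<in>{1..8}. x i * flip {a..b} (j i))"
        unfolding j(2) x_def using strict_mono_on_imp_inj_on[OF j(1)] by (simp add: sum.reindex)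
      also have "\<dots> = (\<Sum>i\<in>{1..8}. x i - 2 * (if a \<le> j i \<and> j i \<le> b then x i else 0))"
        by (intro sum.cong) (auto simp: flip_def)
      also have "\<dots> = - 2 * B"
        using total sum.inter_filter[of "{1..8}" x "\<lambda>i. a \<le> j i \<and> j i \<le> b"]
        by (simp add: sum_subtractf sum_distrib_left[symmetric] B_def conj_assoc)
      finally show ?thesis .
    qed
    ultimately show ?thesis by auto
  qed
  ultimately show ?thesis using neighborly_2_reorient_iff by blast
qed

text \<open>Sets with at most two elements are determined by the smallest interval containing them.\<close>

lemma alternating_count_ge:
  assumes "1 \<le> n"
  shows "2 * card {S. S \<subseteq> {1..n} - {n} \<and> card S \<le> 2} \<le> alternating_count 7 n 2"
proof -
  let ?M = "alternating_om 7 n"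
  let ?P = "{S. S \<subseteq> {1..n} - {n} \<and> card S \<le> 2}"
  let ?F = "{R. R \<subseteq> ground ?M - {n} \<and> neighborly 2 (reorient R ?M)}"
  have E: "ground ?M = {1..n}" by (simp add: alternating_om_def)
  define interval_hull :: "nat set \<Rightarrow> nat set" where "interval_hull S = (if S = {} then {} else {Min S..Max S})" for S
  have nonempty: "S \<subseteq> {Min S..Max S} \<and> {Min S..Max S} \<noteq> {} \<and> S = {Min S, Max S}"
    if "S \<in> ?P" "S \<noteq> {}" for S
  proof -
    have "finite S" "card S \<le> 2" using that finite_subset by auto
    have "card S = 1 \<or> card S = 2" using \<open>finite S\<close> \<open>card S \<le> 2\<close> that(2) by (cases "card S") auto
    then have "\<exists>x y. S = {x, y}" by (auto simp: card_1_singleton_iff card_2_iff)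
    then show ?thesis by (auto simp: min_def max_def split: if_splits)
  qed
  have "card ?P \<le> card ?F"
  proof (rule card_inj_on_le)
    show "inj_on interval_hull ?P"
    proof (rule inj_onI)
      fix S T assume ST: "S \<in> ?P" "T \<in> ?P" "interval_hull S = interval_hull T"
      show "S = T"
      proof (cases "S = {} \<or> T = {}")
        case True
        then show ?thesis using ST nonempty by (auto simp: interval_hull_def split: if_splits)
      next
        case False
        then have "{Min S..Max S} = {Min T..Max T}" using ST(3) by (simp add: interval_hull_def)
        then have "Min S = Min T \<and> Max S = Max T"
          using nonempty[OF ST(1)] nonempty[OF ST(2)] False by auto
        then show ?thesis using nonempty[OF ST(1)] nonempty[OF ST(2)] False by metis
      qed
    qed
    show "interval_hull ` ?P \<subseteq> ?F"
    proof (rule image_subsetI)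
      fix S assume S: "S \<in> ?P"
      \<comment> \<open>The empty set also is an interval reorientation.\<close>
      have "{} = {1..0::nat}" by simp
      then have "\<exists>a b. interval_hull S = {a..b}" unfolding interval_hull_def by metis
      then have "neighborly 2 (reorient (interval_hull S) ?M)"
        using interval_reorientation_neighborly by metis
      moreover have "interval_hull S \<subseteq> {1..n} - {n}"
      proof (cases "S = {}")
        case False
        have "finite S" using S finite_subset by auto
        then have "Min S \<in> S" "Max S \<in> S" using False by auto
        then have "1 \<le> Min S" "Max S < n" using S by fastforce+
        then show ?thesis using False by (auto simp: interval_hull_def)
      qed (simp add: interval_hull_def)
      ultimately show "interval_hull S \<in> ?F" unfolding E by blast
    qed
    show "finite ?F" unfolding E by simp
  qed
  moreover have "num_neighborly_reorientations ?M 2 = 2 * card ?F"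
    by (rule num_neighborly_reorientations_eq_twice) (use assms in \<open>auto simp: alternating_om_def\<close>)
  ultimately show ?thesis unfolding alternating_count_def by simp
qed

theorem corollary2p26:
  fixes n :: nat and M :: "nat signed_system"
  assumes "n \<ge> 11"
    and "is_lawrence_om 7 n M"
  shows "num_neighborly_reorientations M 2 \<le> alternating_count 7 n 2"
proof -
  have E: "ground M = {1..n}" and sv: "circuits M \<subseteq> sign_vectors (ground M)"
    using assms(2) by (auto simp: is_lawrence_om_def lawrence_om_def)
  have "support ` circuits M = {J. J \<subseteq> ground M \<and> card J = 8}"
    using circuit_supports_lawrence_om[OF assms(2)] by simp
  then have "num_neighborly_reorientations M 2 \<le> 2 * card {S. S \<subseteq> ground M - {n} \<and> card S \<le> 2}"
    using assms(1) sv E by (intro card_neighborly_reorientations_le) auto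
  also have "\<dots> \<le> alternating_count 7 n 2"
    unfolding E using assms(1) by (intro alternating_count_ge) simp
  finally show ?thesis .
qed

end
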